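(* Let $(P_n)_{n\ge1}$ be a sequence of probability measures on $(D,\mathcal D)$, where $D=D[0,1]$ carries the Skorokhod topology and $\mathcal D$ is its Borel $\sigma$-algebra. The sequence $(P_n)$ is tight if and only if the following two conditions hold: (i) $\lim_{a\to\infty}\limsup_{n\to\infty}P_n(x:\|x\|\ge a)=0$; (ii) for all $\epsilon,\eta>0$ there exist $\delta\in(0,1)$ and $n_0>0$ such that for all $n>n_0$, $$P_n(x:w''_x(\delta)\ge\epsilon)\le\eta,\qquad P_n(x:|x(\delta)-x(0)|\ge\epsilon)\le\eta,\qquad P_n(x:|x(1-)-x(1-\delta)|\ge\epsilon)\le\eta.$$
   Context: $D=D[0,1]$ is the space of functions $x:[0,1]\to\mathbb R$ that are right continuous and have left-hand limits; $\|x\|=\sup_{0\le t\le1}|x(t)|$ and $x(1-)$ is the left-hand limit at $1$. Let $\Lambda$ be the class of strictly increasing continuous maps $\lambda:[0,1]\to[0,1]$ with $\lambda 0=0$, $\lambda1=1$. The Skorokhod topology on $D$ is the one generated by the metric $d(x,y)=\inf_{\lambda\in\Lambda}\{\sup_t|\lambda t-t|\vee\|x-y\circ\lambda\|\}$. For $\delta\in(0,1)$, $w''_x(\delta)=\sup\{|x(t)-x(t_1)|\wedge|x(t_2)-x(t)|\}$, the supremum being over all triples $t_1,t,t_2\in[0,1]$ with $t_1\le t\le t_2\le t_1+\delta$. A sequence $(P_n)$ is tight if for every $\epsilon>0$ there is a compact set $K\subset D$ with $P_n(K)>1-\epsilon$ for all $n$. *)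

theory Defs
  imports "HOL-Probability.Probability"
begin

section \<open>The space $D[0,1]$\<close>

text \<open>
  Elements are functions on the reals that are \<^const>\<open>extensional\<close> on the unit interval, so that
  equality in the type is equality of functions on $[0,1]$.
\<close>

definition cadlag_on_unit :: "(real \<Rightarrow> real) \<Rightarrow> bool" where
  "cadlag_on_unit x \<longleftrightarrow>
     (\<forall>t\<in>{0..<1}. (x \<longlongrightarrow> x t) (at_right t)) \<and>
     (\<forall>t\<in>{0<..1}. \<exists>l. (x \<longlongrightarrow> l) (at_left t))"

typedef skorokhod = "{x :: real \<Rightarrow> real. x \<in> extensional {0..1} \<and> cadlag_on_unit x}"
  morphisms cadlag_fun Abs_skorokhod
proof
  have "((\<lambda>t. if t \<in> {0..1} then 0 else undefined) \<longlongrightarrow> 0) (at_right t)" if "t \<in> {0..<1}" for t :: real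
    using that by (intro tendsto_eventually) (auto simp: eventually_at_right[of t 1] intro!: exI[of _ 1])
  moreover have "((\<lambda>t. if t \<in> {0..1} then 0 else undefined) \<longlongrightarrow> 0) (at_left t)" if "t \<in> {0<..1}" for t :: real
    using that by (intro tendsto_eventually) (auto simp: eventually_at_left[of 0 t] intro!: exI[of _ 0])
  ultimately show "(\<lambda>t. if t \<in> {0..1} then 0 else undefined)
      \<in> {x :: real \<Rightarrow> real. x \<in> extensional {0..1} \<and> cadlag_on_unit x}"
    unfolding cadlag_on_unit_def extensional_def
    by (intro CollectI conjI ballI exI[of _ 0]) simp_all
qed

declare [[coercion cadlag_fun]]

lemma cadlag_right_cont: "0 \<le> t \<Longrightarrow> t < 1 \<Longrightarrow> (cadlag_fun x \<longlongrightarrow> cadlag_fun x t) (at_right t)"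
  using cadlag_fun[of x] by (auto simp: cadlag_on_unit_def)

lemma cadlag_left_lim: "0 < t \<Longrightarrow> t \<le> 1 \<Longrightarrow> \<exists>l. (cadlag_fun x \<longlongrightarrow> l) (at_left t)"
  using cadlag_fun[of x] by (auto simp: cadlag_on_unit_def)

lemma skorokhod_eqI:
  assumes "\<And>t. t \<in> {0..1} \<Longrightarrow> cadlag_fun x t = cadlag_fun y t"
  shows "x = y"
proof -
  have "cadlag_fun x = cadlag_fun y"
    by (rule extensionalityI[of _ "{0..1}"]) (use cadlag_fun[of x] cadlag_fun[of y] assms in auto)
  then show ?thesis by (simp add: cadlag_fun_inject)
qed

definition unif_norm :: "(real \<Rightarrow> real) \<Rightarrow> real" where
  "unif_norm f = (SUP t\<in>{0..1}. \<bar>f t\<bar>)"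

definition left_lim :: "(real \<Rightarrow> real) \<Rightarrow> real \<Rightarrow> real" where
  "left_lim x t = Lim (at_left t) x"

text \<open>Cadlag functions are bounded, so the real suprema below are genuine suprema.\<close>

lemma cadlag_bounded: "\<exists>M. \<forall>t\<in>{0..1}. \<bar>cadlag_fun x t\<bar> \<le> M"
proof -
  let ?f = "cadlag_fun x"
  define B where "B U = (\<exists>M. \<forall>t\<in>U \<inter> {0..1}. \<bar>?f t\<bar> \<le> M)" for U
  have R: "\<exists>b>t. B {t<..<b}" if t: "0 \<le> t" for t
  proof (cases "t < 1")
    case True
    from tendstoD[OF cadlag_right_cont[OF t True, of x], of 1]
    obtain b where b: "b > t" "\<forall>y>t. y < b \<longrightarrow> dist (?f y) (?f t) < 1"
      by (auto simp: eventually_at_right[OF True])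
    have "\<bar>?f y\<bar> \<le> \<bar>?f t\<bar> + 1" if "y \<in> {t<..<b}" for y
      using b(2) that by (force simp: dist_real_def)
    with b(1) show ?thesis unfolding B_def by blast
  next
    case False
    then have "B {t<..<t+1}" by (auto simp: B_def)
    then show ?thesis by (intro exI[of _ "t+1"]) auto
  qed
  have L: "\<exists>a<t. B {a<..<t}" if t: "t \<le> 1" for t
  proof (cases "0 < t")
    case True
    obtain l where "(?f \<longlongrightarrow> l) (at_left t)" using cadlag_left_lim[OF True t] by blast
    from tendstoD[OF this, of 1]
    obtain a where a: "a < t" "\<forall>y>a. y < t \<longrightarrow> dist (?f y) l < 1"
      by (auto simp: eventually_at_left[OF True])
    have "\<bar>?f y\<bar> \<le> \<bar>l\<bar> + 1" if "y \<in> {a<..<t}" for y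
      using a(2) that by (force simp: dist_real_def)
    with a(1) show ?thesis unfolding B_def by blast
  next
    case False
    then have "B {t-1<..<t}" by (auto simp: B_def)
    then show ?thesis by (intro exI[of _ "t-1"]) auto
  qed
  have Bsub: "B V" if "B U" "V \<subseteq> U" for U V
    using that unfolding B_def by blast
  have BUn: "B (U \<union> V)" if UV: "B U" "B V" for U V
  proof -
    obtain M N where "\<forall>t\<in>U \<inter> {0..1}. \<bar>?f t\<bar> \<le> M" "\<forall>t\<in>V \<inter> {0..1}. \<bar>?f t\<bar> \<le> N"
      using UV unfolding B_def by blast
    then have "\<forall>t\<in>(U \<union> V) \<inter> {0..1}. \<bar>?f t\<bar> \<le> max M N"
      by (auto simp: le_max_iff_disj)
    then show ?thesis unfolding B_def by blast
  qed
  have loc: "\<exists>U. open U \<and> t \<in> U \<and> B U" if "t \<in> {0..1}" for t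
  proof -
    obtain a b where ab: "a < t" "t < b" "B {a<..<t}" "B {t<..<b}"
      using R[of t] L[of t] \<open>t \<in> {0..1}\<close> by auto
    have "B {t}" unfolding B_def by auto
    then have "B ({a<..<t} \<union> {t} \<union> {t<..<b})" using ab by (intro BUn)
    then have "B {a<..<b}" by (rule Bsub) auto
    with ab show ?thesis by (intro exI[of _ "{a<..<b}"]) auto
  qed
  define C where "C = {U. open U \<and> B U}"
  have "{0..1} \<subseteq> \<Union>C" using loc unfolding C_def by blast
  moreover have "open U" if "U \<in> C" for U using that unfolding C_def by blast
  ultimately obtain C' where C': "C' \<subseteq> C" "finite C'" "{0..1} \<subseteq> \<Union>C'"
    by (rule compactE[OF compact_Icc])
  have "B (\<Union>C')" using C'(2) C'(1)
  proof (induction rule: finite_induct)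
    case empty
    show ?case by (simp add: B_def)
  next
    case (insert U F)
    then have "B U" "B (\<Union>F)" by (auto simp: C_def)
    then have "B (U \<union> \<Union>F)" by (rule BUn)
    then show ?case by simp
  qed
  with C'(3) show ?thesis unfolding B_def by (meson IntI subsetD)
qed

section \<open>The Skorokhod metric\<close>

definition time_changes :: "(real \<Rightarrow> real) set" ("\<Lambda>") where
  "\<Lambda> = {l. l \<in> {0..1} \<rightarrow> {0..1} \<and> strict_mono_on {0..1} l \<and> continuous_on {0..1} l \<and> l 0 = 0 \<and> l 1 = 1}"

lemma time_change_range: "l \<in> \<Lambda> \<Longrightarrow> t \<in> {0..1} \<Longrightarrow> l t \<in> {0..1}"
  by (auto simp: time_changes_def)

lemma time_changes_id: "(\<lambda>t. t) \<in> \<Lambda>"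
  by (auto simp: time_changes_def strict_mono_on_def)

lemma time_changes_comp:
  assumes "l \<in> \<Lambda>" "m \<in> \<Lambda>"
  shows "(\<lambda>t. m (l t)) \<in> \<Lambda>"
proof -
  have "continuous_on {0..1} (\<lambda>t. m (l t))"
    by (rule continuous_on_compose2[of "{0..1}" m]) (use assms in \<open>auto simp: time_changes_def\<close>)
  moreover have "strict_mono_on {0..1} (\<lambda>t. m (l t))"
    using assms unfolding time_changes_def strict_mono_on_def Pi_iff by simp
  ultimately show ?thesis
    using assms unfolding time_changes_def by auto
qed

lemma time_changes_inverse:
  assumes l: "l \<in> \<Lambda>"
  shows "\<exists>m\<in>\<Lambda>. (\<forall>t\<in>{0..1}. m (l t) = t \<and> l (m t) = t)"
proof -
  have sm: "strict_mono_on {0..1} l" and cont: "continuous_on {0..1} l"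
    and l01: "l 0 = 0" "l 1 = 1" and ran: "\<And>t. t \<in> {0..1} \<Longrightarrow> l t \<in> {0..1}"
    using l by (auto simp: time_changes_def)
  have inj: "inj_on l {0..1}" using sm by (rule strict_mono_on_imp_inj_on)
  have surj: "l ` {0..1} = {0..1}"
  proof
    show "{0..1} \<subseteq> l ` {0..1}"
    proof
      fix y :: real assume "y \<in> {0..1}"
      then show "y \<in> l ` {0..1}"
        using IVT'[of l 0 y 1] cont l01 by auto
    qed
  qed (use ran in auto)
  define m where "m = the_inv_into {0..1} l"
  have ml: "m (l t) = t" if "t \<in> {0..1}" for t
    unfolding m_def using inj that by (simp add: the_inv_into_f_f)
  have lm: "l (m t) = t" if "t \<in> {0..1}" for t
    unfolding m_def using inj that surj by (simp add: f_the_inv_into_f)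
  have mr: "m t \<in> {0..1}" if "t \<in> {0..1}" for t
    unfolding m_def using the_inv_into_into[OF inj, of t "{0..1}"] that surj by auto
  have "continuous_on (l ` {0..1}) m"
    by (rule continuous_on_inv[OF cont compact_Icc]) (use ml in auto)
  then have mc: "continuous_on {0..1} m" using surj by simp
  have "m s < m t" if st: "s \<in> {0..1}" "t \<in> {0..1}" "s < t" for s t
  proof (rule ccontr)
    assume "\<not> m s < m t"
    then have "l (m t) \<le> l (m s)"
      using sm mr[OF st(1)] mr[OF st(2)]
      by (metis linorder_not_less order.strict_iff_order strict_mono_onD)
    then show False using lm st by auto
  qed
  then have "strict_mono_on {0..1} m" by (auto simp: strict_mono_on_def)
  moreover have "m 0 = 0" "m 1 = 1" using ml[of 0] ml[of 1] l01 by auto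
  ultimately have "m \<in> \<Lambda>" using mc mr by (auto simp: time_changes_def)
  with ml lm show ?thesis by blast
qed

instantiation skorokhod :: metric_space
begin

definition dist_skorokhod :: "skorokhod \<Rightarrow> skorokhod \<Rightarrow> real" where
  "dist_skorokhod x y =
     (INF l\<in>\<Lambda>. max (unif_norm (\<lambda>t. l t - t)) (unif_norm (\<lambda>t. x t - y (l t))))"

definition uniformity_skorokhod :: "(skorokhod \<times> skorokhod) filter" where
  "uniformity_skorokhod = (INF e\<in>{0<..}. principal {(x, y). dist x y < e})"

definition open_skorokhod :: "skorokhod set \<Rightarrow> bool" where
  "open_skorokhod S = (\<forall>x\<in>S. \<forall>\<^sub>F (x', y) in uniformity. x' = x \<longrightarrow> y \<in> S)"

lemma unif_norm_upper:
  assumes "\<And>t. t \<in> {0..1} \<Longrightarrow> \<bar>f t\<bar> \<le> M" "t \<in> {0..1}"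
  shows "\<bar>f t\<bar> \<le> unif_norm f"
  unfolding unif_norm_def by (rule cSUP_upper) (use assms in \<open>auto intro!: bdd_aboveI2[where M=M]\<close>)

lemma unif_norm_least: "(\<And>t. t \<in> {0..1} \<Longrightarrow> \<bar>f t\<bar> \<le> M) \<Longrightarrow> unif_norm f \<le> M"
  unfolding unif_norm_def by (rule cSUP_least) auto

lemma time_change_dist_upper: "l \<in> \<Lambda> \<Longrightarrow> t \<in> {0..1} \<Longrightarrow> \<bar>l t - t\<bar> \<le> unif_norm (\<lambda>t. l t - t)"
proof (rule unif_norm_upper[of _ 1])
  fix t :: real assume "l \<in> \<Lambda>" "t \<in> {0..1}"
  then show "\<bar>l t - t\<bar> \<le> 1" using time_change_range[of l t] by (auto simp: abs_le_iff)
qed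

lemma cadlag_diff_upper:
  assumes l: "l \<in> \<Lambda>" and t: "t \<in> {0..1}"
  shows "\<bar>cadlag_fun x t - cadlag_fun y (l t)\<bar> \<le> unif_norm (\<lambda>t. x t - y (l t))"
proof -
  obtain M N where M: "\<forall>t\<in>{0..1}. \<bar>cadlag_fun x t\<bar> \<le> M" and N: "\<forall>t\<in>{0..1}. \<bar>cadlag_fun y t\<bar> \<le> N"
    using cadlag_bounded[of x] cadlag_bounded[of y] by blast
  show ?thesis
  proof (rule unif_norm_upper[of _ "M + N", OF _ t])
    fix t :: real assume t: "t \<in> {0..1}"
    have "\<bar>cadlag_fun x t\<bar> \<le> M" "\<bar>cadlag_fun y (l t)\<bar> \<le> N"
      using M N t time_change_range[OF l t] by blast+
    then show "\<bar>cadlag_fun x t - cadlag_fun y (l t)\<bar> \<le> M + N" by linarith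
  qed
qed

lemma dist_skorokhod_lessD:
  assumes "dist (x :: skorokhod) y < e"
  shows "\<exists>l\<in>\<Lambda>. \<forall>t\<in>{0..1}. \<bar>l t - t\<bar> < e \<and> \<bar>x t - y (l t)\<bar> < e"
proof -
  obtain l where l: "l \<in> \<Lambda>"
    and le: "max (unif_norm (\<lambda>t. l t - t)) (unif_norm (\<lambda>t. x t - y (l t))) < e"
  proof -
    let ?c = "\<lambda>l. max (unif_norm (\<lambda>t. l t - t)) (unif_norm (\<lambda>t. x t - y (l t)))"
    have "?c ` \<Lambda> \<noteq> {}" using time_changes_id by (simp only: image_is_empty) fast
    moreover have "Inf (?c ` \<Lambda>) < e" using assms by (simp add: dist_skorokhod_def)
    ultimately have "\<exists>c\<in>?c ` \<Lambda>. c < e" by (rule cInf_lessD)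
    then obtain l where "l \<in> \<Lambda>" "?c l < e" by (elim bexE imageE) simp
    then show ?thesis by (rule that)
  qed
  show ?thesis
  proof (intro bexI[OF _ l] ballI)
    fix t :: real assume "t \<in> {0..1}"
    with le time_change_dist_upper[OF l this] cadlag_diff_upper[OF l this, of x y]
    show "\<bar>l t - t\<bar> < e \<and> \<bar>x t - y (l t)\<bar> < e" by auto
  qed
qed

lemma dist_skorokhod_leI:
  fixes x y :: skorokhod
  assumes l: "l \<in> \<Lambda>"
    and le: "\<And>t. t \<in> {0..1} \<Longrightarrow> \<bar>l t - t\<bar> \<le> e" "\<And>t. t \<in> {0..1} \<Longrightarrow> \<bar>x t - y (l t)\<bar> \<le> e"
  shows "dist x y \<le> e"
proof -
  let ?c = "\<lambda>l. max (unif_norm (\<lambda>t. l t - t)) (unif_norm (\<lambda>t. x t - y (l t)))"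
  have "bdd_below (?c ` \<Lambda>)"
  proof (rule bdd_belowI2)
    fix l assume "l \<in> \<Lambda>"
    then have "0 \<le> unif_norm (\<lambda>t. l t - t)"
      using time_change_dist_upper[of l 0] by (auto simp: time_changes_def)
    then show "0 \<le> ?c l" by simp
  qed
  then have "Inf (?c ` \<Lambda>) \<le> ?c l" using l by (rule cINF_lower)
  also have "?c l \<le> e" using le by (auto intro!: unif_norm_least)
  finally show ?thesis by (simp add: dist_skorokhod_def)
qed

lemma dist_skorokhod_triangle2: "dist (x :: skorokhod) y \<le> dist x z + dist y z"
proof (rule field_le_epsilon)
  fix e :: real assume e: "e > 0"
  define a b where "a = dist x z + e / 2" and "b = dist y z + e / 2"
  obtain l where l: "l \<in> \<Lambda>" "\<forall>t\<in>{0..1}. \<bar>l t - t\<bar> < a \<and> \<bar>x t - z (l t)\<bar> < a"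
    using dist_skorokhod_lessD[of x z a] e by (auto simp: a_def)
  obtain m where m: "m \<in> \<Lambda>" "\<forall>t\<in>{0..1}. \<bar>m t - t\<bar> < b \<and> \<bar>y t - z (m t)\<bar> < b"
    using dist_skorokhod_lessD[of y z b] e by (auto simp: b_def)
  obtain k where k: "k \<in> \<Lambda>" "\<forall>t\<in>{0..1}. k (m t) = t \<and> m (k t) = t"
    using time_changes_inverse[OF m(1)] by blast
  have "dist x y \<le> a + b"
  proof (rule dist_skorokhod_leI[OF time_changes_comp[OF l(1) k(1)]])
    fix t :: real assume t: "t \<in> {0..1}"
    have lt: "l t \<in> {0..1}" and kt: "k (l t) \<in> {0..1}"
      using time_change_range[OF l(1) t] time_change_range[OF k(1)] by auto
    have "\<bar>l t - t\<bar> < a" "\<bar>x t - z (l t)\<bar> < a" using l(2) t by auto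
    moreover have "\<bar>l t - k (l t)\<bar> < b" "\<bar>y (k (l t)) - z (l t)\<bar> < b"
      using bspec[OF m(2) kt] bspec[OF k(2) lt] by auto
    ultimately show "\<bar>k (l t) - t\<bar> \<le> a + b" "\<bar>x t - y (k (l t))\<bar> \<le> a + b"
      by linarith+
  qed
  then show "dist x y \<le> dist x z + dist y z + e" by (simp add: a_def b_def)
qed

lemma dist_skorokhod_eq0D:
  assumes "dist (x :: skorokhod) y = 0"
  shows "x = y"
proof (rule skorokhod_eqI)
  have ap: "\<exists>s\<in>{0..1}. \<bar>s - t\<bar> < e \<and> \<bar>x t - y s\<bar> < e" if "t \<in> {0..1}" "e > 0" for t e :: real
  proof -
    obtain l where l: "l \<in> \<Lambda>" "\<forall>t\<in>{0..1}. \<bar>l t - t\<bar> < e \<and> \<bar>x t - y (l t)\<bar> < e"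
      using dist_skorokhod_lessD[of x y e] assms \<open>e > 0\<close> by auto
    show ?thesis
    proof (rule bexI[of _ "l t"])
      show "l t \<in> {0..1}" using l(1) \<open>t \<in> {0..1}\<close> by (rule time_change_range)
      show "\<bar>l t - t\<bar> < e \<and> \<bar>x t - y (l t)\<bar> < e" using l(2) \<open>t \<in> {0..1}\<close> by (rule bspec)
    qed
  qed
  fix t :: real assume t: "t \<in> {0..1}"
  show "x t = y t"
  proof (cases "t = 1")
    case True
    have "\<bar>x 1 - y 1\<bar> \<le> e" if "e > 0" for e
    proof -
      obtain l where l: "l \<in> \<Lambda>" "\<forall>t\<in>{0..1}. \<bar>l t - t\<bar> < e \<and> \<bar>x t - y (l t)\<bar> < e"
        using dist_skorokhod_lessD[of x y e] assms \<open>e > 0\<close> by auto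
      have "l 1 = 1" using l(1) by (simp add: time_changes_def)
      then show ?thesis using bspec[OF l(2), of 1] by simp
    qed
    then have "\<bar>x 1 - y 1\<bar> \<le> 0" by (rule dense_ge)
    then show ?thesis using True by simp
  next
    case False
    with t have t1: "0 \<le> t" "t < 1" by auto
    have "\<bar>x t - y t\<bar> \<le> e" if e: "e > 0" for e
    proof -
      have e3: "e / 3 > 0" using e by simp
      obtain b where b: "b > t" "\<forall>s>t. s < b \<longrightarrow> dist (x s) (x t) < e / 3"
        using tendstoD[OF cadlag_right_cont[OF t1, of x] e3] by (auto simp: eventually_at_right[OF t1(2)])
      obtain c where c: "c > t" "\<forall>s>t. s < c \<longrightarrow> dist (y s) (y t) < e / 3"
        using tendstoD[OF cadlag_right_cont[OF t1, of y] e3] by (auto simp: eventually_at_right[OF t1(2)])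
      define d where "d = min 1 (min b c)"
      have d: "t < d" "d \<le> 1" "d \<le> b" "d \<le> c" using b c t1 by (auto simp: d_def)
      define s where "s = (t + d) / 2"
      have s: "t < s" "s < d" using d by (auto simp: s_def)
      define r where "r = min (e / 3) (min (s - t) (d - s))"
      have "s \<in> {0..1}" "r > 0" using s d t1 e by (auto simp: r_def)
      from ap[OF this] obtain u where u: "\<bar>u - s\<bar> < r" "\<bar>x s - y u\<bar> < r" by blast
      have r: "r \<le> e / 3" "r \<le> s - t" "r \<le> d - s" unfolding r_def by linarith+
      have "t < u" "u < c" using u r s d by linarith+
      then have 1: "\<bar>y u - y t\<bar> < e / 3" using c(2) by (auto simp: dist_real_def)
      have "\<bar>x s - x t\<bar> < e / 3" using b(2) s d by (auto simp: dist_real_def)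
      with 1 u r show ?thesis by linarith
    qed
    then have "\<bar>x t - y t\<bar> \<le> 0" by (rule dense_ge)
    then show ?thesis by simp
  qed
qed

instance
proof
  fix x y z :: skorokhod
  show "dist x y \<le> dist x z + dist y z" by (rule dist_skorokhod_triangle2)
  show "dist x y = 0 \<longleftrightarrow> x = y"
  proof
    assume "x = y"
    then have "dist x y \<le> 0"
      using dist_skorokhod_leI[OF time_changes_id, of 0 x y] by auto
    moreover have "0 \<le> dist x y"
      using dist_skorokhod_triangle2[of x x y] calculation \<open>x = y\<close> by simp
    ultimately show "dist x y = 0" by simp
  qed (rule dist_skorokhod_eq0D)
qed (rule open_skorokhod_def uniformity_skorokhod_def)+

end

section \<open>Modulus and tightness\<close>

definition modulus_w'' :: "(real \<Rightarrow> real) \<Rightarrow> real \<Rightarrow> real" where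
  "modulus_w'' x \<delta> = Sup {min \<bar>x t - x t\<^sub>1\<bar> \<bar>x t\<^sub>2 - x t\<bar> |t\<^sub>1 t t\<^sub>2.
     {t\<^sub>1, t, t\<^sub>2} \<subseteq> {0..1 :: real} \<and> t\<^sub>1 \<le> t \<and> t \<le> t\<^sub>2 \<and> t\<^sub>2 \<le> t\<^sub>1 + \<delta>}"

text \<open>The constant \<^const>\<open>tight\<close> of the library is restricted to measures on the real line.\<close>

definition tight_seq :: "(nat \<Rightarrow> 'a::topological_space measure) \<Rightarrow> bool" where
  "tight_seq P \<longleftrightarrow> (\<forall>\<epsilon>>0::real. \<exists>K. compact K \<and> (\<forall>n. measure (P n) K > 1 - \<epsilon>))"

end

theory Submission
  imports Defs "HOL-Library.Diagonal_Subsequence"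
begin

text \<open>
  Tightness is reduced to two facts about the Skorokhod space. Call a path \<open>x\<close> regular at \<open>(\<delta>, e)\<close> if
  \<open>w''\<^sub>x(\<delta>)\<close>, \<open>\<bar>x \<delta> - x 0\<bar>\<close> and \<open>\<bar>x(1-) - x (1 - \<delta>)\<bar>\<close> are all less than \<open>e\<close>. Condition (ii) speaks of the
  probability that a path is not regular.

  The first fact (\<open>regular_near\<close>) is that every path has a neighbourhood all of whose members are regular
  at \<open>(\<delta>, e)\<close> for every sufficiently small \<open>\<delta>\<close>. By a finite cover, a compact set is uniformly regular;
  it is also bounded, so tightness implies (i) and (ii). Applied to a single path, the same fact shows that one
  probability measure gives mass close to one to the regular paths as \<open>\<delta>\<close> decreases to zero. This
  extends (i) and (ii) from all large \<open>n\<close> to all \<open>n\<close>.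

  The second fact is a compactness criterion, and it has two halves. If \<open>x\<close> is regular at \<open>(\<delta>, e)\<close>, then
  \<open>[0,1]\<close> splits into intervals of length at least \<open>\<delta> / 2\<close> on which \<open>x\<close> is within \<open>6 * e\<close> of its
  value at the left end (\<open>regular_sparse_partition\<close>). The reason is that after a move by \<open>e\<close> a regular path
  cannot move by \<open>e\<close> again for some time, so such moves can be used as division points without getting
  close to each other. In the other half (\<open>sparse_partitions_convergent_subseq\<close>), a uniformly bounded
  sequence of paths has such partitions with gaps at least \<open>d k\<close> and errors \<open>e k\<close> tending to zero, the
  same for all paths. A partition has at most \<open>1 / d k\<close> cells, so it is described, together with the values at
  its division points, by boundedly many bounded numbers. A diagonal subsequence makes all these numbers
  converge. The limiting step functions converge uniformly to a cadlag function, and the subsequence converges to it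
  after piecewise linear time changes that match the division points. The lower bound on the gaps keeps the
  limiting division points distinct, without which no strictly increasing time change could match them.

  A measure takes the value zero on non-measurable sets by convention, so (i) and (ii) carry information only
  because the sets in them are Borel. This follows from right continuity, which reduces everything
  to countably many evaluations.
\<close>

section \<open>Measurability of the functionals in the tightness conditions\<close>

lemma unif_norm_abs_le: "t \<in> {0..1} \<Longrightarrow> \<bar>cadlag_fun x t\<bar> \<le> unif_norm x"
  using cadlag_bounded[of x] by (auto intro: unif_norm_upper)

text \<open>
  A time change does not alter the supremum of a path, so the norm is 1-Lipschitz for the Skorokhod metric.
\<close>

lemma unif_norm_le_add_dist:
  fixes x y :: skorokhod
  shows "unif_norm y \<le> unif_norm x + dist y x"
proof (rule field_le_epsilon)
  fix e :: real assume e: "e > 0"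
  then obtain l where l: "l \<in> \<Lambda>"
    "\<forall>t\<in>{0..1}. \<bar>l t - t\<bar> < dist y x + e \<and> \<bar>y t - x (l t)\<bar> < dist y x + e"
    using dist_skorokhod_lessD[of y x "dist y x + e"] by auto
  show "unif_norm y \<le> unif_norm x + dist y x + e"
  proof (rule unif_norm_least)
    fix t :: real assume t: "t \<in> {0..1}"
    have "\<bar>x (l t)\<bar> \<le> unif_norm x" by (rule unif_norm_abs_le[OF time_change_range[OF l(1) t]])
    with l(2) t show "\<bar>y t\<bar> \<le> unif_norm x + dist y x + e" by force
  qed
qed

lemma measurable_unif_norm: "(\<lambda>x::skorokhod. unif_norm x) \<in> borel_measurable borel"
proof (rule borel_measurable_continuous_onI)
  have "1-lipschitz_on UNIV (\<lambda>x::skorokhod. unif_norm x)"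
  proof (rule lipschitz_onI)
    fix x y :: skorokhod
    show "dist (unif_norm x) (unif_norm y) \<le> 1 * dist x y"
      using unif_norm_le_add_dist[of x y] unif_norm_le_add_dist[of y x]
      by (simp add: dist_real_def dist_commute abs_le_iff)
  qed simp
  then show "continuous_on UNIV (\<lambda>x::skorokhod. unif_norm x)"
    by (rule lipschitz_on_continuous_on)
qed

lemma unif_norm_ge_measurable: "{x::skorokhod. unif_norm x \<ge> a} \<in> sets borel"
proof -
  have "{x \<in> space borel. unif_norm (cadlag_fun x) \<ge> a} \<in> sets borel"
    using measurable_unif_norm by measurable
  then show ?thesis by simp
qed

text \<open>
  Evaluation at an interior point is not continuous on \<open>D\<close>, but the supremum over an open time
  interval is lower semicontinuous, since a given point of the interval stays inside it under small time changes.
\<close>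

lemma open_exceeds_on_open_interval:
  "open {x::skorokhod. \<exists>s\<in>{a<..<b} \<inter> {0..1}. c < x s}"
  unfolding open_dist
proof clarify
  fix x :: skorokhod and s :: real
  assume s: "s \<in> {a<..<b}" "s \<in> {0..1}" and c: "c < x s"
  define r where "r = min (x s - c) (min (s - a) (b - s))"
  have r: "r > 0" "r \<le> x s - c" "r \<le> s - a" "r \<le> b - s"
    using s c unfolding r_def by auto
  show "\<exists>e>0. \<forall>y. dist y x < e \<longrightarrow> y \<in> {x. \<exists>s\<in>{a<..<b} \<inter> {0..1}. c < cadlag_fun x s}"
  proof (intro exI[of _ r] conjI allI impI)
    fix y assume "dist y x < r"
    then obtain l where l: "l \<in> \<Lambda>" "\<forall>t\<in>{0..1}. \<bar>l t - t\<bar> < r \<and> \<bar>x t - y (l t)\<bar> < r"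
      using dist_skorokhod_lessD[of x y r] by (auto simp: dist_commute)
    have "\<bar>l s - s\<bar> < r" "\<bar>x s - y (l s)\<bar> < r" "l s \<in> {0..1}"
      using l s(2) time_change_range by blast+
    with r show "y \<in> {x. \<exists>s\<in>{a<..<b} \<inter> {0..1}. c < cadlag_fun x s}"
      by (intro CollectI bexI[of _ "l s"]) auto
  qed (use r in auto)
qed

lemma right_cont_less:
  assumes "0 \<le> t" "t < 1" "e > 0"
  obtains h where "t < h" "h \<le> 1" "\<And>s. t \<le> s \<Longrightarrow> s < h \<Longrightarrow> \<bar>cadlag_fun x s - cadlag_fun x t\<bar> < e"
proof -
  obtain b where b: "b > t" "\<forall>s>t. s < b \<longrightarrow> dist (cadlag_fun x s) (cadlag_fun x t) < e"
    using tendstoD[OF cadlag_right_cont[OF assms(1,2), of x] assms(3)]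
    by (auto simp: eventually_at_right[OF assms(2)])
  show ?thesis
  proof (rule that[of "min b 1"])
    fix s assume "t \<le> s" "s < min b 1"
    then show "\<bar>cadlag_fun x s - cadlag_fun x t\<bar> < e"
      using b assms(3) by (cases "s = t") (auto simp: dist_real_def)
  qed (use b assms in auto)
qed

lemma left_limit_less:
  assumes "0 < t" "t \<le> 1" "e > 0" "(cadlag_fun x \<longlongrightarrow> l) (at_left t)"
  obtains h where "h < t" "0 \<le> h" "\<And>s. h < s \<Longrightarrow> s < t \<Longrightarrow> \<bar>cadlag_fun x s - l\<bar> < e"
proof -
  obtain b where b: "b < t" "\<forall>s>b. s < t \<longrightarrow> dist (cadlag_fun x s) l < e"
    using tendstoD[OF assms(4,3)] by (auto simp: eventually_at_left[OF assms(1)])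
  show ?thesis
    by (rule that[of "max b 0"]) (use b assms in \<open>auto simp: dist_real_def\<close>)
qed

text \<open>
  By right continuity \<open>x t\<close> is, at an interior time, the limit of the suprema over the intervals
  \<open>{t<..<t + 1 / k}\<close>. The time \<open>1\<close> is fixed by all time changes, so evaluation there is even continuous.
\<close>

lemma measurable_eval:
  assumes t: "t \<in> {0..1}"
  shows "(\<lambda>x::skorokhod. x t) \<in> borel_measurable borel"
proof (cases "t = 1")
  case True
  have "1-lipschitz_on UNIV (\<lambda>x::skorokhod. x 1)"
  proof (rule lipschitz_onI)
    fix x y :: skorokhod
    have "dist (x 1) (y 1) \<le> dist x y + e" if e: "e > 0" for e
    proof -
      obtain l where l: "l \<in> \<Lambda>"
        "\<forall>t\<in>{0..1}. \<bar>l t - t\<bar> < dist x y + e \<and> \<bar>x t - y (l t)\<bar> < dist x y + e"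
        using dist_skorokhod_lessD[of x y "dist x y + e"] e by auto
      have "l 1 = 1" using l(1) by (simp add: time_changes_def)
      then show ?thesis using bspec[OF l(2), of 1] by (simp add: dist_real_def)
    qed
    then show "dist (x 1) (y 1) \<le> 1 * dist x y" by (simp add: field_le_epsilon)
  qed simp
  then show ?thesis
    unfolding True by (intro borel_measurable_continuous_onI lipschitz_on_continuous_on)
next
  case False
  then have t1: "0 \<le> t" "t < 1" using t by auto
  show ?thesis
    unfolding borel_measurable_iff_less
  proof
    fix c :: real
    define U where "U k = {t<..<t + 1 / real (Suc k)}" for k
    define S where "S k m = {x::skorokhod. \<exists>s\<in>U k \<inter> {0..1}. c - 1 / real (Suc m) < x s}" for k m
    have "{x::skorokhod. x t < c} = (\<Union>k. \<Union>m. - S k m)" (is "?L = ?R")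
    proof (rule subset_antisym; rule subsetI)
      fix x :: skorokhod assume "x \<in> ?L"
      define e where "e = (c - x t) / 2"
      have e: "e > 0" "x t + 2 * e = c"
        using \<open>x \<in> ?L\<close> by (auto simp: e_def diff_divide_distrib)
      obtain m where m: "1 / real (Suc m) < e" using nat_approx_posE[OF e(1)] .
      obtain h where h: "t < h" "h \<le> 1" "\<And>s. t \<le> s \<Longrightarrow> s < h \<Longrightarrow> \<bar>x s - x t\<bar> < e"
        using right_cont_less[OF t1 e(1), of x] by metis
      obtain k where k: "1 / real (Suc k) < h - t"
        using nat_approx_posE[of "h - t"] h(1) by auto
      have "x \<notin> S k m"
      proof
        assume "x \<in> S k m"
        then obtain s where s: "s \<in> U k" "c - 1 / real (Suc m) < x s" by (auto simp: S_def)
        then have "x s < x t + e"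
          using h(3)[of s] k by (auto simp: U_def abs_less_iff)
        with s(2) m e(2) show False by linarith
      qed
      then show "x \<in> ?R" by blast
    next
      fix x :: skorokhod assume "x \<in> ?R"
      then obtain k m where km: "x \<notin> S k m" by blast
      have mp: "1 / real (Suc m) > 0" by simp
      obtain h where h: "t < h" "h \<le> 1" "\<And>s. t \<le> s \<Longrightarrow> s < h \<Longrightarrow> \<bar>x s - x t\<bar> < 1 / real (Suc m)"
        using right_cont_less[OF t1 mp, of x] by auto
      have "t < min h (t + 1 / real (Suc k))" using h(1) by simp
      then obtain s where s: "t < s" "s < h" "s < t + 1 / real (Suc k)"
        using dense[of t "min h (t + 1 / real (Suc k))"] by auto
      then have "s \<in> U k \<inter> {0..1}" using h t1 by (auto simp: U_def)
      then have "x s \<le> c - 1 / real (Suc m)" using km by (auto simp: S_def not_less)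
      with h(3)[of s] s show "x \<in> ?L" by (auto simp: abs_less_iff)
    qed
    moreover have "S k m \<in> sets borel" for k m
      using open_exceeds_on_open_interval[of t "t + 1 / real (Suc k)"]
      by (simp add: S_def U_def)
    ultimately show "{x \<in> space borel. cadlag_fun x t < c} \<in> sets borel"
      by (simp add: borel_comp)
  qed
qed

lemma tendsto_left_lim:
  assumes "0 < t" "t \<le> 1"
  shows "(cadlag_fun x \<longlongrightarrow> left_lim x t) (at_left t)"
proof -
  obtain l where l: "(cadlag_fun x \<longlongrightarrow> l) (at_left t)" using cadlag_left_lim[OF assms] by blast
  then have "left_lim x t = l" unfolding left_lim_def by (intro tendsto_Lim) simp_all
  with l show ?thesis by simp
qed

lemma measurable_left_lim: "(\<lambda>x::skorokhod. left_lim x 1) \<in> borel_measurable borel"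
proof (rule borel_measurable_LIMSEQ_real)
  fix x :: skorokhod
  have "filterlim (\<lambda>i. 1 - 1 / real (Suc i)) (at_left 1) sequentially"
  proof (rule filterlim_at_withinI)
    have "(\<lambda>i. 1 - 1 / real (Suc i)) \<longlonglongrightarrow> 1 - 0" by (intro tendsto_diff LIMSEQ_Suc[OF lim_1_over_n] tendsto_const)
    then show "filterlim (\<lambda>i. 1 - 1 / real (Suc i)) (nhds 1) sequentially" by simp
  qed auto
  then show "(\<lambda>i. x (1 - 1 / real (Suc i))) \<longlonglongrightarrow> left_lim x 1"
    by (rule filterlim_compose[OF tendsto_left_lim, rotated 2]) simp_all
next
  fix i :: nat
  show "(\<lambda>x::skorokhod. x (1 - 1 / real (Suc i))) \<in> borel_measurable borel"
    by (rule measurable_eval) simp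
qed

lemma less_modulus_w''_iff:
  assumes "\<delta> \<ge> 0"
  shows "c < modulus_w'' (cadlag_fun x) \<delta> \<longleftrightarrow>
    (\<exists>t1 t t2. 0 \<le> t1 \<and> t1 \<le> t \<and> t \<le> t2 \<and> t2 \<le> 1 \<and> t2 \<le> t1 + \<delta> \<and> c < min \<bar>x t - x t1\<bar> \<bar>x t2 - x t\<bar>)"
proof -
  let ?T = "{min \<bar>x t - x t1\<bar> \<bar>x t2 - x t\<bar> |t1 t t2.
     {t1, t, t2} \<subseteq> {0..1 :: real} \<and> t1 \<le> t \<and> t \<le> t2 \<and> t2 \<le> t1 + \<delta>}"
  obtain M where M: "\<And>t. t \<in> {0..1} \<Longrightarrow> \<bar>x t\<bar> \<le> M" using cadlag_bounded[of x] by blast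
  have "bdd_above ?T"
  proof (rule bdd_aboveI[of _ "2 * M"])
    fix v assume "v \<in> ?T"
    then obtain t1 t t2 where v: "v = min \<bar>x t - x t1\<bar> \<bar>x t2 - x t\<bar>" "t \<in> {0..1}" "t1 \<in> {0..1}" by auto
    then show "v \<le> 2 * M" using M[of t] M[of t1] by linarith
  qed
  moreover have "min \<bar>x 0 - x 0\<bar> \<bar>x 0 - x 0\<bar> \<in> ?T"
    using assms by (intro CollectI exI[of _ 0]) simp
  then have "?T \<noteq> {}" by blast
  ultimately have "c < modulus_w'' (cadlag_fun x) \<delta> \<longleftrightarrow> (\<exists>v\<in>?T. c < v)"
    unfolding modulus_w''_def by (intro less_cSup_iff)
  also have "\<dots> \<longleftrightarrow> (\<exists>t1 t t2. 0 \<le> t1 \<and> t1 \<le> t \<and> t \<le> t2 \<and> t2 \<le> 1 \<and> t2 \<le> t1 + \<delta> \<and> c < min \<bar>x t - x t1\<bar> \<bar>x t2 - x t\<bar>)"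
  proof
    assume "\<exists>v\<in>?T. c < v"
    then obtain t1 t t2 where "{t1, t, t2} \<subseteq> {0..1}" "t1 \<le> t" "t \<le> t2" "t2 \<le> t1 + \<delta>"
      "c < min \<bar>x t - x t1\<bar> \<bar>x t2 - x t\<bar>" by blast
    then show "\<exists>t1 t t2. 0 \<le> t1 \<and> t1 \<le> t \<and> t \<le> t2 \<and> t2 \<le> 1 \<and> t2 \<le> t1 + \<delta> \<and> c < min \<bar>x t - x t1\<bar> \<bar>x t2 - x t\<bar>"
      by auto
  next
    assume "\<exists>t1 t t2. 0 \<le> t1 \<and> t1 \<le> t \<and> t \<le> t2 \<and> t2 \<le> 1 \<and> t2 \<le> t1 + \<delta> \<and> c < min \<bar>x t - x t1\<bar> \<bar>x t2 - x t\<bar>"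
    then obtain t1 t t2 where *: "0 \<le> t1" "t1 \<le> t" "t \<le> t2" "t2 \<le> 1" "t2 \<le> t1 + \<delta>" "c < min \<bar>x t - x t1\<bar> \<bar>x t2 - x t\<bar>"
      by blast
    then have "min \<bar>x t - x t1\<bar> \<bar>x t2 - x t\<bar> \<in> ?T"
      by (intro CollectI exI[of _ t1] exI[of _ t] exI[of _ t2]) auto
    with * show "\<exists>v\<in>?T. c < v" by blast
  qed
  finally show ?thesis .
qed

lemma right_approx_Rats:
  assumes "0 \<le> t" "t < 1" "t < b" "e > 0"
  obtains u where "u \<in> \<rat>" "t < u" "u < b" "u < 1" "\<bar>cadlag_fun x u - cadlag_fun x t\<bar> < e"
proof -
  obtain h where h: "t < h" "h \<le> 1" "\<And>s. t \<le> s \<Longrightarrow> s < h \<Longrightarrow> \<bar>cadlag_fun x s - cadlag_fun x t\<bar> < e"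
    using right_cont_less[OF assms(1,2,4), of x] by metis
  have "t < min h b" using h assms by simp
  then obtain u where "u \<in> \<rat>" "t < u" "u < min h b" using Rats_dense_in_real by blast
  with h show ?thesis by (intro that[of u]) auto
qed

text \<open>
  Right continuity lets a triple \<open>t1 < t < t2\<close> be moved to rational times without leaving the set of
  admissible triples: \<open>t1\<close> moves first, which leaves room to the right of \<open>t2\<close> even when
  \<open>t2 = t1 + \<delta>\<close>. The endpoint \<open>1\<close> is itself rational.
\<close>

lemma less_modulus_w''_iff_Rats:
  assumes \<delta>: "\<delta> \<ge> 0" and c: "c \<ge> 0"
  shows "c < modulus_w'' (cadlag_fun x) \<delta> \<longleftrightarrow>
    (\<exists>t1\<in>\<rat>. \<exists>t\<in>\<rat>. \<exists>t2\<in>\<rat>. 0 \<le> t1 \<and> t1 \<le> t \<and> t \<le> t2 \<and> t2 \<le> 1 \<and> t2 \<le> t1 + \<delta> \<and>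
       c < min \<bar>x t - x t1\<bar> \<bar>x t2 - x t\<bar>)" (is "?L \<longleftrightarrow> ?R")
proof
  assume ?L
  then obtain t1 t t2 where T: "0 \<le> t1" "t1 \<le> t" "t \<le> t2" "t2 \<le> 1" "t2 \<le> t1 + \<delta>"
    and big: "c < min \<bar>x t - x t1\<bar> \<bar>x t2 - x t\<bar>"
    unfolding less_modulus_w''_iff[OF \<delta>] by blast
  define e where "e = (min \<bar>x t - x t1\<bar> \<bar>x t2 - x t\<bar> - c) / 2"
  have e: "e > 0" "c + 2 * e \<le> \<bar>x t - x t1\<bar>" "c + 2 * e \<le> \<bar>x t2 - x t\<bar>"
    using big unfolding e_def by (auto simp: min_def field_simps)
  have "t1 \<noteq> t" "t \<noteq> t2" using big c by auto
  with T have lt: "t1 < t" "t < t2" by auto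
  obtain u1 where u1: "u1 \<in> \<rat>" "t1 < u1" "u1 < t" "\<bar>x u1 - x t1\<bar> < e"
    using right_approx_Rats[of t1 t e x] T lt e by auto
  obtain u where u: "u \<in> \<rat>" "t < u" "u < t2" "\<bar>x u - x t\<bar> < e"
    using right_approx_Rats[of t t2 e x] T lt e by auto
  obtain u2 where u2: "u2 \<in> \<rat>" "t2 \<le> u2" "u2 \<le> u1 + \<delta>" "u2 \<le> 1" "\<bar>x u2 - x t2\<bar> < e"
  proof (cases "t2 = 1")
    case True
    then show ?thesis using that[of 1] T u1 e by simp
  next
    case False
    have "t2 < u1 + \<delta>" using T u1 by linarith
    then obtain u2 where "u2 \<in> \<rat>" "t2 < u2" "u2 < u1 + \<delta>" "u2 < 1" "\<bar>x u2 - x t2\<bar> < e"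
      using right_approx_Rats[of t2 "u1 + \<delta>" e x] T lt e False by auto
    then show ?thesis using that[of u2] by simp
  qed
  have "c < min \<bar>x u - x u1\<bar> \<bar>x u2 - x u\<bar>" using e u1(4) u(4) u2(5) by linarith
  moreover have "0 \<le> u1" "u1 \<le> u" "u \<le> u2" using T u1 u u2 by linarith+
  ultimately show ?R using u1 u u2 by blast
next
  assume ?R
  then show ?L unfolding less_modulus_w''_iff[OF \<delta>] by blast
qed

lemma measurable_modulus_w'':
  assumes \<delta>: "\<delta> \<ge> 0"
  shows "(\<lambda>x::skorokhod. modulus_w'' x \<delta>) \<in> borel_measurable borel"
  unfolding borel_measurable_iff_greater
proof
  fix c :: real
  show "{x \<in> space borel. c < modulus_w'' (cadlag_fun x) \<delta>} \<in> sets borel"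
  proof (cases "c < 0")
    case True
    have "c < modulus_w'' (cadlag_fun x) \<delta>" for x
      unfolding less_modulus_w''_iff[OF \<delta>] by (intro exI[of _ 0]) (use True \<delta> in simp)
    then show ?thesis by simp
  next
    case False
    define C where "C = {(t1, t, t2). t1 \<in> \<rat> \<and> t \<in> \<rat> \<and> t2 \<in> \<rat> \<and>
      0 \<le> t1 \<and> t1 \<le> t \<and> t \<le> t2 \<and> t2 \<le> 1 \<and> t2 \<le> t1 + \<delta>}"
    have "C \<subseteq> \<rat> \<times> \<rat> \<times> \<rat>" unfolding C_def by auto
    then have "countable C" by (rule countable_subset) (auto intro: countable_rat)
    moreover have "{x \<in> space borel. c < modulus_w'' (cadlag_fun x) \<delta>} =
      (\<Union>(t1, t, t2)\<in>C. {x. c < min \<bar>cadlag_fun x t - cadlag_fun x t1\<bar> \<bar>cadlag_fun x t2 - cadlag_fun x t\<bar>})"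
      unfolding C_def using False by (auto simp: less_modulus_w''_iff_Rats[OF \<delta>])
    moreover have "{x. c < min \<bar>cadlag_fun x t - cadlag_fun x t1\<bar> \<bar>cadlag_fun x t2 - cadlag_fun x t\<bar>} \<in> sets borel"
      if "(t1, t, t2) \<in> C" for t1 t t2
    proof -
      have [measurable]: "(\<lambda>x. cadlag_fun x t) \<in> borel_measurable borel"
        "(\<lambda>x. cadlag_fun x t1) \<in> borel_measurable borel" "(\<lambda>x. cadlag_fun x t2) \<in> borel_measurable borel"
        using that by (auto simp: C_def intro!: measurable_eval)
      have "{x \<in> space borel. c < min \<bar>cadlag_fun x t - cadlag_fun x t1\<bar> \<bar>cadlag_fun x t2 - cadlag_fun x t\<bar>} \<in> sets borel"
        by measurable
      then show ?thesis by simp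
    qed
    ultimately show ?thesis by (auto intro!: sets.countable_UN')
  qed
qed

section \<open>Regularity at both endpoints and in the interior\<close>

text \<open>
  The paths that lie outside all three events of condition (ii) with \<open>\<epsilon> = e\<close>.
\<close>

definition regular :: "real \<Rightarrow> real \<Rightarrow> skorokhod set" where
  "regular \<delta> e = {x::skorokhod. modulus_w'' x \<delta> < e \<and> \<bar>x \<delta> - x 0\<bar> < e \<and> \<bar>left_lim x 1 - x (1 - \<delta>)\<bar> < e}"

lemma irregular_measurable:
  assumes "0 < \<delta>" "\<delta> < 1"
  shows "{x::skorokhod. modulus_w'' x \<delta> \<ge> e} \<in> sets borel"
    "{x::skorokhod. \<bar>x \<delta> - x 0\<bar> \<ge> e} \<in> sets borel"
    "{x::skorokhod. \<bar>left_lim x 1 - x (1 - \<delta>)\<bar> \<ge> e} \<in> sets borel"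
proof -
  have [measurable]: "(\<lambda>x. modulus_w'' (cadlag_fun x) \<delta>) \<in> borel_measurable borel"
    "(\<lambda>x. cadlag_fun x \<delta>) \<in> borel_measurable borel" "(\<lambda>x. cadlag_fun x 0) \<in> borel_measurable borel"
    "(\<lambda>x. cadlag_fun x (1 - \<delta>)) \<in> borel_measurable borel"
    "(\<lambda>x. left_lim (cadlag_fun x) 1) \<in> borel_measurable borel"
    using assms by (auto intro: measurable_eval measurable_left_lim measurable_modulus_w'')
  have "{x \<in> space borel. modulus_w'' (cadlag_fun x) \<delta> \<ge> e} \<in> sets borel"
    "{x \<in> space borel. \<bar>cadlag_fun x \<delta> - cadlag_fun x 0\<bar> \<ge> e} \<in> sets borel"
    "{x \<in> space borel. \<bar>left_lim (cadlag_fun x) 1 - cadlag_fun x (1 - \<delta>)\<bar> \<ge> e} \<in> sets borel"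
    by measurable
  then show "{x::skorokhod. modulus_w'' x \<delta> \<ge> e} \<in> sets borel"
    "{x::skorokhod. \<bar>x \<delta> - x 0\<bar> \<ge> e} \<in> sets borel"
    "{x::skorokhod. \<bar>left_lim x 1 - x (1 - \<delta>)\<bar> \<ge> e} \<in> sets borel"
    by simp_all
qed

lemma regular_eq_Compl:
  "regular \<delta> e = - ({x. modulus_w'' (cadlag_fun x) \<delta> \<ge> e} \<union> {x. \<bar>cadlag_fun x \<delta> - cadlag_fun x 0\<bar> \<ge> e} \<union>
    {x. \<bar>left_lim (cadlag_fun x) 1 - cadlag_fun x (1 - \<delta>)\<bar> \<ge> e})"
  unfolding regular_def by auto

lemma regular_measurable:
  assumes "0 < \<delta>" "\<delta> < 1"
  shows "regular \<delta> e \<in> sets borel"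
  unfolding regular_eq_Compl using irregular_measurable[OF assms] by (intro borel_comp sets.Un)

lemma modulus_w''_le_iff:
  assumes "\<delta> \<ge> 0"
  shows "modulus_w'' (cadlag_fun x) \<delta> \<le> c \<longleftrightarrow>
    (\<forall>t1 t t2. 0 \<le> t1 \<longrightarrow> t1 \<le> t \<longrightarrow> t \<le> t2 \<longrightarrow> t2 \<le> 1 \<longrightarrow> t2 \<le> t1 + \<delta> \<longrightarrow> min \<bar>x t - x t1\<bar> \<bar>x t2 - x t\<bar> \<le> c)"
  using less_modulus_w''_iff[OF assms, of c x] unfolding not_less[symmetric] by blast

text \<open>
  Around each time a cadlag function oscillates little on either side; a Lebesgue number of the
  resulting cover of \<open>[0,1]\<close> is a common length scale. Of three close times, the middle one and one of
  the others lie on the same side of the centre of a covering interval.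
\<close>

lemma cadlag_oscillation_scale:
  fixes x :: skorokhod
  assumes e: "e > 0"
  obtains \<rho> where "\<rho> > 0" "\<rho> < 1"
    "\<And>t1 t t2. 0 \<le> t1 \<Longrightarrow> t1 \<le> t \<Longrightarrow> t \<le> t2 \<Longrightarrow> t2 \<le> 1 \<Longrightarrow> t2 < t1 + \<rho> \<Longrightarrow>
      min \<bar>x t - x t1\<bar> \<bar>x t2 - x t\<bar> < e"
    "\<And>s s'. s \<in> {0..<\<rho>} \<Longrightarrow> s' \<in> {0..<\<rho>} \<Longrightarrow> \<bar>x s - x s'\<bar> < e"
    "\<And>s s'. s \<in> {1-\<rho><..<1} \<Longrightarrow> s' \<in> {1-\<rho><..<1} \<Longrightarrow> \<bar>x s - x s'\<bar> < e"
proof -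
  define ok where "ok t h \<longleftrightarrow> h > 0 \<and> (\<forall>s\<in>{t-h<..<t} \<inter> {0..1}. \<forall>s'\<in>{t-h<..<t} \<inter> {0..1}. \<bar>x s - x s'\<bar> < e) \<and>
     (\<forall>s\<in>{t..<t+h} \<inter> {0..1}. \<forall>s'\<in>{t..<t+h} \<inter> {0..1}. \<bar>x s - x s'\<bar> < e)" for t h
  have e2: "e / 2 > 0" using e by simp
  have "\<exists>h. ok t h" if t: "t \<in> {0..1}" for t
  proof -
    have "\<exists>h>0. \<forall>s\<in>{t..<t+h} \<inter> {0..1}. \<bar>x s - x t\<bar> < e / 2"
    proof (cases "t = 1")
      case True
      then show ?thesis using e by (intro exI[of _ 1]) auto
    next
      case False
      then have "0 \<le> t" "t < 1" using t by auto
      then obtain h where "t < h" "h \<le> 1" "\<And>s. t \<le> s \<Longrightarrow> s < h \<Longrightarrow> \<bar>x s - x t\<bar> < e / 2"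
        using right_cont_less[OF _ _ e2, of t x] by metis
      then show ?thesis by (intro exI[of _ "h - t"]) auto
    qed
    then obtain h where h: "h > 0" "\<And>s. s\<in>{t..<t+h} \<inter> {0..1} \<Longrightarrow> \<bar>x s - x t\<bar> < e / 2" by blast
    have "\<exists>k>0. \<exists>c. \<forall>s\<in>{t-k<..<t} \<inter> {0..1}. \<bar>x s - c\<bar> < e / 2"
    proof (cases "t = 0")
      case True
      then show ?thesis by (intro exI[of _ 1]) auto
    next
      case False
      then have "0 < t" "t \<le> 1" using t by auto
      then obtain k where "k < t" "0 \<le> k" "\<And>s. k < s \<Longrightarrow> s < t \<Longrightarrow> \<bar>x s - left_lim x t\<bar> < e / 2"
        using left_limit_less[OF _ _ e2 tendsto_left_lim, of t x] by metis
      then show ?thesis by (intro exI[of _ "t - k"] conjI exI[of _ "left_lim x t"]) auto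
    qed
    then obtain k c where k: "k > 0" "\<And>s. s \<in>{t-k<..<t} \<inter> {0..1} \<Longrightarrow> \<bar>x s - c\<bar> < e / 2" by blast
    have "ok t (min h k)"
      unfolding ok_def
    proof (intro conjI ballI)
      fix s s' assume "s \<in> {t - min h k<..<t} \<inter> {0..1}" "s' \<in> {t - min h k<..<t} \<inter> {0..1}"
      then have "s \<in> {t - k<..<t} \<inter> {0..1}" "s' \<in> {t - k<..<t} \<inter> {0..1}" by auto
      then have "\<bar>x s - c\<bar> < e / 2" "\<bar>x s' - c\<bar> < e / 2" using k(2)[of s] k(2)[of s'] by blast+
      then show "\<bar>x s - x s'\<bar> < e" by linarith
    next
      fix s s' assume "s \<in> {t..<t + min h k} \<inter> {0..1}" "s' \<in> {t..<t + min h k} \<inter> {0..1}"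
      then have "s \<in> {t..<t + h} \<inter> {0..1}" "s' \<in> {t..<t + h} \<inter> {0..1}" by auto
      then have "\<bar>x s - x t\<bar> < e / 2" "\<bar>x s' - x t\<bar> < e / 2" using h(2)[of s] h(2)[of s'] by blast+
      then show "\<bar>x s - x s'\<bar> < e" by linarith
    qed (use h k in auto)
    then show ?thesis by blast
  qed
  then obtain h where h: "\<And>t. t \<in> {0..1} \<Longrightarrow> ok t (h t)" by metis
  define C where "C = (\<lambda>t. {t - h t<..<t + h t}) ` {0..1}"
  have "{0..1} \<subseteq> \<Union>C"
  proof
    fix t :: real assume t: "t \<in> {0..1}"
    then have "t \<in> {t - h t<..<t + h t}" using h[OF t] by (simp add: ok_def)
    with t show "t \<in> \<Union>C" unfolding C_def by blast
  qed
  then obtain r where r: "r > 0" "\<And>t. t \<in> {0..1} \<Longrightarrow> \<exists>G\<in>C. ball t r \<subseteq> G"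
    by (rule Heine_Borel_lemma[OF compact_Icc]) (auto simp: C_def)
  define \<rho> where "\<rho> = min (1/2) (min r (min (h 0) (h 1)))"
  have \<rho>: "\<rho> > 0" "\<rho> < 1" "\<rho> \<le> r" "\<rho> \<le> h 0" "\<rho> \<le> h 1"
    using r(1) h[of 0] h[of 1] unfolding \<rho>_def ok_def by auto
  show ?thesis
  proof (rule that[of \<rho>])
    fix t1 t t2 assume T: "0 \<le> t1" "t1 \<le> t" "t \<le> t2" "t2 \<le> 1" "t2 < t1 + \<rho>"
    then obtain \<tau> where \<tau>: "\<tau> \<in> {0..1}" "ball t1 r \<subseteq> {\<tau> - h \<tau><..<\<tau> + h \<tau>}"
      using r(2)[of t1] unfolding C_def by auto
    have "{t1, t, t2} \<subseteq> ball t1 r" using T \<rho> r(1) by (auto simp: dist_real_def)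
    then have in_h: "{t1, t, t2} \<subseteq> {\<tau> - h \<tau><..<\<tau> + h \<tau>}" using \<tau>(2) by blast
    show "min \<bar>x t - x t1\<bar> \<bar>x t2 - x t\<bar> < e"
    proof (cases "\<tau> \<le> t")
      case True
      then have "t \<in> {\<tau>..<\<tau> + h \<tau>} \<inter> {0..1}" "t2 \<in> {\<tau>..<\<tau> + h \<tau>} \<inter> {0..1}" using T in_h by auto
      then have "\<bar>x t2 - x t\<bar> < e" using h[OF \<tau>(1)] unfolding ok_def by blast
      then show ?thesis by simp
    next
      case False
      then have "t \<in> {\<tau> - h \<tau><..<\<tau>} \<inter> {0..1}" "t1 \<in> {\<tau> - h \<tau><..<\<tau>} \<inter> {0..1}" using T in_h by auto
      then have "\<bar>x t - x t1\<bar> < e" using h[OF \<tau>(1)] unfolding ok_def by blast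
      then show ?thesis by simp
    qed
  next
    fix s s' assume "s \<in> {0..<\<rho>}" "s' \<in> {0..<\<rho>}"
    then have "s \<in> {0..<0 + h 0} \<inter> {0..1}" "s' \<in> {0..<0 + h 0} \<inter> {0..1}" using \<rho> by auto
    then show "\<bar>x s - x s'\<bar> < e" using h[of 0] unfolding ok_def by auto
  next
    fix s s' assume "s \<in> {1-\<rho><..<1}" "s' \<in> {1-\<rho><..<1}"
    then have "s \<in> {1 - h 1<..<1} \<inter> {0..1}" "s' \<in> {1 - h 1<..<1} \<inter> {0..1}" using \<rho> by auto
    then show "\<bar>x s - x s'\<bar> < e" using h[of 1] unfolding ok_def by auto
  qed (use \<rho> in auto)
qed

text \<open>
  A nearby path is, up to an error \<open>r\<close>, the path \<open>x\<close> run with a clock that is off by at most \<open>r\<close>. So it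
  inherits the oscillation bounds of \<open>x\<close> at a slightly smaller scale. The case \<open>y = x\<close> says that each
  single path is eventually regular; the uniformity in \<open>y\<close> is what a compact set needs.
\<close>

lemma regular_near:
  fixes x :: skorokhod
  assumes e: "e > 0"
  obtains r \<delta>0 where "r > 0" "\<delta>0 > 0" "\<And>y \<delta>. dist y x < r \<Longrightarrow> 0 < \<delta> \<Longrightarrow> \<delta> \<le> \<delta>0 \<Longrightarrow> y \<in> regular \<delta> e"
proof -
  have "e / 4 > 0" using e by simp
  then obtain \<rho> where \<rho>: "\<rho> > 0" "\<rho> < 1"
    and mid: "\<And>t1 t t2. 0 \<le> t1 \<Longrightarrow> t1 \<le> t \<Longrightarrow> t \<le> t2 \<Longrightarrow> t2 \<le> 1 \<Longrightarrow> t2 < t1 + \<rho> \<Longrightarrow>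
      min \<bar>x t - x t1\<bar> \<bar>x t2 - x t\<bar> < e / 4"
    and start: "\<And>s s'. s \<in> {0..<\<rho>} \<Longrightarrow> s' \<in> {0..<\<rho>} \<Longrightarrow> \<bar>x s - x s'\<bar> < e / 4"
    and fin: "\<And>s s'. s \<in> {1-\<rho><..<1} \<Longrightarrow> s' \<in> {1-\<rho><..<1} \<Longrightarrow> \<bar>x s - x s'\<bar> < e / 4"
    by (rule cadlag_oscillation_scale[of "e / 4" x]) blast
  define r where "r = min (\<rho> / 3) (e / 8)"
  have r: "r > 0" "3 * r \<le> \<rho>" "8 * r \<le> e" unfolding r_def using \<rho> e by auto
  show ?thesis
  proof (rule that[of r "\<rho> / 3"])
    fix y :: skorokhod and \<delta> :: real
    assume d: "dist y x < r" and \<delta>: "0 < \<delta>" "\<delta> \<le> \<rho> / 3"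
    obtain l where l: "l \<in> \<Lambda>" and close: "\<And>t. t\<in>{0..1} \<Longrightarrow> \<bar>l t - t\<bar> < r"
      "\<And>t. t\<in>{0..1} \<Longrightarrow> \<bar>y t - x (l t)\<bar> < r"
      using dist_skorokhod_lessD[OF d] by blast
    have lr: "\<And>t. t \<in> {0..1} \<Longrightarrow> l t \<in> {0..1}" by (rule time_change_range[OF l])
    have sm: "\<And>s t. s \<in> {0..1} \<Longrightarrow> t \<in> {0..1} \<Longrightarrow> s < t \<Longrightarrow> l s < l t"
      and l01: "l 0 = 0" "l 1 = 1"
      using l by (auto simp: time_changes_def strict_mono_on_def)
    have mono: "l s \<le> l t" if "0 \<le> s" "s \<le> t" "t \<le> 1" for s t
      using sm[of s t] that by (cases "s = t") auto
    have "modulus_w'' y \<delta> \<le> e / 4 + 2 * r"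
      unfolding modulus_w''_le_iff[OF less_imp_le[OF \<delta>(1)]]
    proof (intro allI impI)
      fix t1 t t2 assume T: "0 \<le> t1" "t1 \<le> t" "t \<le> t2" "t2 \<le> 1" "t2 \<le> t1 + \<delta>"
      then have in01: "t1 \<in> {0..1}" "t \<in> {0..1}" "t2 \<in> {0..1}" by auto
      have "min \<bar>x (l t) - x (l t1)\<bar> \<bar>x (l t2) - x (l t)\<bar> < e / 4"
      proof (rule mid)
        show "l t2 < l t1 + \<rho>" using close(1)[OF in01(1)] close(1)[OF in01(3)] T \<delta> r by linarith
      qed (use T in01 mono lr[of t1] lr[of t2] in auto)
      then show "min \<bar>y t - y t1\<bar> \<bar>y t2 - y t\<bar> \<le> e / 4 + 2 * r"
        using close(2)[OF in01(1)] close(2)[OF in01(2)] close(2)[OF in01(3)] by linarith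
    qed
    moreover have "\<bar>y \<delta> - y 0\<bar> < e"
    proof -
      have "\<delta> \<in> {0..1}" using \<delta> \<rho> by auto
      then have "l \<delta> \<in> {0..<\<rho>}" using close(1)[of \<delta>] lr[of \<delta>] \<delta> r \<rho> by auto
      then have "\<bar>x (l \<delta>) - x (l 0)\<bar> < e / 4" using start[of "l \<delta>" 0] l01 \<rho> by simp
      moreover have "\<bar>y 0 - x (l 0)\<bar> < r" by (rule close(2)) simp
      ultimately show ?thesis using close(2)[OF \<open>\<delta> \<in> {0..1}\<close>] r e by linarith
    qed
    moreover have "\<bar>left_lim y 1 - y (1 - \<delta>)\<bar> \<le> e / 4 + 2 * r"
    proof (rule tendsto_upperbound)
      show "((\<lambda>t. \<bar>y t - y (1 - \<delta>)\<bar>) \<longlongrightarrow> \<bar>left_lim y 1 - y (1 - \<delta>)\<bar>) (at_left 1)"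
        by (intro tendsto_intros tendsto_left_lim) auto
      have *: "\<bar>y t - y (1 - \<delta>)\<bar> \<le> e / 4 + 2 * r" if t: "1 - \<delta> < t" "t < 1" for t
      proof -
        have in01: "1 - \<delta> \<in> {0..1}" "t \<in> {0..1}" using t \<delta> \<rho> by auto
        have "1 - \<rho> < l (1 - \<delta>)" "l (1 - \<delta>) \<le> l t" "l t < 1"
          using close(1)[OF in01(1)] \<delta> r \<rho> mono[of "1 - \<delta>" t] t sm[of t 1] in01 l01 by auto
        then have "\<bar>x (l t) - x (l (1 - \<delta>))\<bar> < e / 4" by (intro fin) auto
        then show ?thesis using close(2)[OF in01(1)] close(2)[OF in01(2)] by linarith
      qed
      show "eventually (\<lambda>t. \<bar>y t - y (1 - \<delta>)\<bar> \<le> e / 4 + 2 * r) (at_left 1)"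
        unfolding eventually_at_left[of "1 - \<delta>" "1::real", simplified, OF \<delta>(1)]
        using * \<delta> by (intro exI[of _ "1 - \<delta>"]) auto
    qed simp
    ultimately show "y \<in> regular \<delta> e"
      unfolding regular_def using r e by auto
  qed (use r \<rho> in auto)
qed

section \<open>Regular paths are nearly step functions with long steps\<close>

text \<open>
  The division points are \<open>t 0, ..., t m\<close>; the oscillation on a cell is measured from the value at its left end.
  The starting time \<open>a\<close> is a parameter so that a partition can be extended to the left.
\<close>

definition sparse_partition :: "real \<Rightarrow> real \<Rightarrow> (real \<Rightarrow> real) \<Rightarrow> real \<Rightarrow> nat \<Rightarrow> (nat \<Rightarrow> real) \<Rightarrow> bool" where
  "sparse_partition d e f a m t \<longleftrightarrow> t 0 = a \<and> t m = 1 \<and>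
     (\<forall>i<m. t i + d \<le> t (Suc i) \<and> (\<forall>s\<in>{t i..<t (Suc i)}. \<bar>f s - f (t i)\<bar> \<le> e))"

lemma sparse_partition_Cons:
  assumes "sparse_partition d e f b m t" "a + d \<le> b" "\<And>s. s \<in> {a..<b} \<Longrightarrow> \<bar>f s - f a\<bar> \<le> e"
  shows "sparse_partition d e f a (Suc m) (case_nat a t)"
  using assms unfolding sparse_partition_def by (auto simp: less_Suc_eq_0_disj split: nat.split)

lemma regular_triple_less:
  assumes "x \<in> regular \<delta> e" "0 \<le> \<delta>" "0 \<le> t1" "t1 \<le> t" "t \<le> t2" "t2 \<le> 1" "t2 \<le> t1 + \<delta>"
  shows "\<bar>cadlag_fun x t - cadlag_fun x t1\<bar> < e \<or> \<bar>cadlag_fun x t2 - cadlag_fun x t\<bar> < e"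
proof -
  have "min \<bar>x t - x t1\<bar> \<bar>x t2 - x t\<bar> \<le> modulus_w'' x \<delta>"
    using modulus_w''_le_iff[OF assms(2), of x "modulus_w'' x \<delta>"] assms(3-) by blast
  also have "\<dots> < e" using assms(1) by (simp add: regular_def)
  finally show ?thesis by linarith
qed

text \<open>
  A path that is at distance \<open>e\<close> or more from its values at both ends of a short time interval would
  violate the bound on \<open>w''\<close>, so closeness of the two end values forces closeness throughout.
\<close>

lemma regular_start:
  assumes "x \<in> regular \<delta> e" "0 < \<delta>" "\<delta> < 1" "0 \<le> s" "s \<le> \<delta>"
  shows "\<bar>cadlag_fun x s - cadlag_fun x 0\<bar> < 2 * e"
proof -
  have "\<bar>x s - x 0\<bar> < e \<or> \<bar>x \<delta> - x s\<bar> < e"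
    by (rule regular_triple_less[OF assms(1)]) (use assms in auto)
  moreover have "\<bar>x \<delta> - x 0\<bar> < e" using assms(1) by (simp add: regular_def)
  ultimately show ?thesis by linarith
qed

lemma regular_end:
  assumes x: "x \<in> regular \<delta> e" and \<delta>: "0 < \<delta>" "\<delta> < 1" and s: "1 - \<delta> \<le> s" "s < 1"
  shows "\<bar>cadlag_fun x s - cadlag_fun x (1 - \<delta>)\<bar> < 2 * e"
proof (cases "\<bar>x s - x (1 - \<delta>)\<bar> < e")
  case True
  then show ?thesis by linarith
next
  case False
  have "\<bar>left_lim x 1 - x s\<bar> \<le> e"
  proof (rule tendsto_upperbound)
    show "((\<lambda>u. \<bar>x u - x s\<bar>) \<longlongrightarrow> \<bar>left_lim x 1 - x s\<bar>) (at_left 1)"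
      by (intro tendsto_intros tendsto_left_lim) auto
    have "\<bar>x u - x s\<bar> \<le> e" if "s < u" "u < 1" for u
      using regular_triple_less[OF x, of "1 - \<delta>" s u] False that s \<delta> by auto
    then show "eventually (\<lambda>u. \<bar>x u - x s\<bar> \<le> e) (at_left 1)"
      using s by (auto simp: eventually_at_left[of s "1::real"])
  qed simp
  moreover have "\<bar>left_lim x 1 - x (1 - \<delta>)\<bar> < e" using x by (simp add: regular_def)
  ultimately show ?thesis by linarith
qed

text \<open>
  Right continuity makes the infimum of the times at which the path has moved by \<open>e\<close> a minimum.
\<close>

lemma first_exit:
  fixes x :: skorokhod
  assumes b: "0 \<le> b" "b \<le> s" "s < 1" and far: "e \<le> \<bar>x s - x b\<bar>" and e: "e > 0"
  obtains c where "b < c" "c \<le> s" "e \<le> \<bar>x c - x b\<bar>" "\<And>u. u \<in> {b..<c} \<Longrightarrow> \<bar>x u - x b\<bar> < e"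
proof -
  define S where "S = {u \<in> {b..s}. e \<le> \<bar>x u - x b\<bar>}"
  define c where "c = Inf S"
  have "s \<in> S" using b far by (auto simp: S_def)
  moreover have bdd: "bdd_below S" by (auto simp: S_def intro: bdd_belowI[of _ b])
  ultimately have cs: "c \<le> s" unfolding c_def by (rule cInf_lower)
  have bc: "b \<le> c" unfolding c_def by (rule cInf_greatest) (use \<open>s \<in> S\<close> in \<open>auto simp: S_def\<close>)
  have "e \<le> \<bar>x c - x b\<bar>"
  proof (rule ccontr)
    assume "\<not> e \<le> \<bar>x c - x b\<bar>"
    then have p: "e - \<bar>x c - x b\<bar> > 0" by simp
    have "0 \<le> c" "c < 1" using b bc cs by auto
    then obtain h where h: "c < h" "\<And>u. c \<le> u \<Longrightarrow> u < h \<Longrightarrow> \<bar>x u - x c\<bar> < e - \<bar>x c - x b\<bar>"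
      using right_cont_less[OF _ _ p, of c x] by metis
    obtain u where u: "u \<in> S" "u < h"
      using cInf_lessD[of S h] \<open>s \<in> S\<close> h(1) unfolding c_def by blast
    have "c \<le> u" unfolding c_def by (rule cInf_lower[OF u(1) bdd])
    then have "\<bar>x u - x c\<bar> < e - \<bar>x c - x b\<bar>" using h u by blast
    then show False using u(1) by (auto simp: S_def)
  qed
  moreover from this have "b \<noteq> c" using e by auto
  moreover have "\<bar>x u - x b\<bar> < e" if u: "u \<in> {b..<c}" for u
  proof (rule ccontr)
    assume "\<not> \<bar>x u - x b\<bar> < e"
    then have "u \<in> S" using u cs by (auto simp: S_def)
    then have "c \<le> u" unfolding c_def by (rule cInf_lower[OF _ bdd])
    then show False using u by simp
  qed
  ultimately show ?thesis using bc cs by (intro that[of c]) auto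
qed

text \<open>
  The partition is built from left to right through division points \<open>a\<close> after which the path is quiet:
  it stays within \<open>2 * e\<close> of \<open>x a\<close> during \<open>{a..a + \<delta> / 2}\<close>. The next point is \<open>b = a + \<delta> / 2\<close> if
  the path is quiet after \<open>b\<close>. Otherwise it is the first time \<open>c\<close> after \<open>b\<close> at which the path has moved
  by \<open>e\<close>: having just moved, the path cannot move by \<open>e\<close> again before time \<open>b + \<delta>\<close>, so it is quiet
  after \<open>c\<close>. Once \<open>a\<close> is within \<open>3 * \<delta> / 2\<close> of \<open>1\<close>, the control near \<open>1\<close> makes \<open>{a..<1}\<close> one step.
\<close>

lemma regular_sparse_partition_from:
  fixes x :: skorokhod
  assumes x: "x \<in> regular \<delta> e" and \<delta>: "0 < \<delta>" "\<delta> < 1"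
  assumes "0 \<le> a" "a \<le> 1 - \<delta> / 2" "1 - a \<le> real N * (\<delta> / 2)"
    and "\<And>s. s \<in> {a..a + \<delta> / 2} \<Longrightarrow> \<bar>x s - x a\<bar> \<le> 2 * e"
  shows "\<exists>m t. sparse_partition (\<delta> / 2) (6 * e) x a m t"
  using assms(4-)
proof (induction N arbitrary: a)
  case 0
  then show ?case using \<delta> by simp
next
  case (Suc N)
  have e: "e > 0" using x by (auto simp: regular_def)
  define b where "b = a + \<delta> / 2"
  have ab: "\<bar>x s - x a\<bar> \<le> 2 * e" if "s \<in> {a..b}" for s using Suc.prems(4) that by (simp add: b_def)
  have N: "1 - b \<le> real N * (\<delta> / 2)" using Suc.prems(3) by (simp add: b_def field_simps)
  show ?case
  proof (cases "a \<ge> 1 - 3 * (\<delta> / 2)")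
    case True
    have "\<bar>x s - x a\<bar> \<le> 6 * e" if s: "s \<in> {a..<1}" for s
    proof (cases "s \<le> b")
      case True
      then show ?thesis using ab[of s] s e by auto
    next
      case False
      have "1 - \<delta> \<le> b" using \<open>a \<ge> 1 - 3 * (\<delta> / 2)\<close> by (simp add: b_def)
      then have "\<bar>x s - x (1 - \<delta>)\<bar> < 2 * e" "\<bar>x b - x (1 - \<delta>)\<bar> < 2 * e"
        using False s by (auto intro!: regular_end[OF x \<delta>])
      moreover have "\<bar>x b - x a\<bar> \<le> 2 * e" using ab[of b] \<delta> by (simp add: b_def)
      ultimately show ?thesis by linarith
    qed
    then have "sparse_partition (\<delta> / 2) (6 * e) x a 1 (case_nat a (\<lambda>_. 1))"
      using Suc.prems(2) by (auto simp: sparse_partition_def)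
    then show ?thesis by blast
  next
    case False
    then have a: "a + \<delta> < 1 - \<delta> / 2" by simp
    have "\<exists>c\<in>{b..a + \<delta>}. (\<forall>s\<in>{a..<c}. \<bar>x s - x a\<bar> \<le> 3 * e) \<and> (\<forall>s\<in>{c..c + \<delta> / 2}. \<bar>x s - x c\<bar> \<le> 2 * e)"
    proof (cases "\<forall>s\<in>{b..b + \<delta> / 2}. \<bar>x s - x b\<bar> \<le> 2 * e")
      case True
      then show ?thesis using \<delta> e by (intro bexI[of _ b]) (auto simp: b_def intro: order_trans[OF Suc.prems(4)])
    next
      case False
      then obtain s where s: "s \<in> {b..b + \<delta> / 2}" "2 * e < \<bar>x s - x b\<bar>" by (auto simp: not_le)
      have "0 \<le> b" "b \<le> s" "s < 1" "e \<le> \<bar>x s - x b\<bar>"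
        using s Suc.prems(1) \<delta> a e by (auto simp: b_def)
      then obtain c where c: "b < c" "c \<le> s" "e \<le> \<bar>x c - x b\<bar>" "\<And>u. u \<in> {b..<c} \<Longrightarrow> \<bar>x u - x b\<bar> < e"
        using e by (rule first_exit) blast
      have "\<bar>x s - x a\<bar> \<le> 3 * e" if "s \<in> {a..<c}" for s
        using ab[of s] ab[of b] c(4)[of s] that \<delta> e by (cases "s \<le> b") (auto simp: b_def)
      moreover have "\<bar>x u - x c\<bar> \<le> 2 * e" if "u \<in> {c..c + \<delta> / 2}" for u
        using regular_triple_less[OF x, of b c u] c s that \<delta> Suc.prems(1) a e by (auto simp: b_def)
      ultimately show ?thesis using c s by (intro bexI[of _ c]) (auto simp: b_def)
    qed
    then obtain c where c: "b \<le> c" "c \<le> a + \<delta>" "\<And>s. s \<in> {a..<c} \<Longrightarrow> \<bar>x s - x a\<bar> \<le> 3 * e"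
      "\<And>s. s \<in> {c..c + \<delta> / 2} \<Longrightarrow> \<bar>x s - x c\<bar> \<le> 2 * e" by auto
    have "\<exists>m t. sparse_partition (\<delta> / 2) (6 * e) x c m t"
      by (rule Suc.IH) (use c a N Suc.prems(1) \<delta> in \<open>auto simp: b_def\<close>)
    then obtain m t where mt: "sparse_partition (\<delta> / 2) (6 * e) x c m t" by blast
    have "sparse_partition (\<delta> / 2) (6 * e) x a (Suc m) (case_nat a t)"
    proof (rule sparse_partition_Cons[OF mt])
      show "a + \<delta> / 2 \<le> c" using c by (simp add: b_def)
      show "\<bar>x s - x a\<bar> \<le> 6 * e" if "s \<in> {a..<c}" for s using c(3)[OF that] e by simp
    qed
    then show ?thesis by blast
  qed
qed

lemma regular_sparse_partition:
  assumes x: "x \<in> regular \<delta> e" and \<delta>: "0 < \<delta>" "\<delta> < 1"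
  shows "\<exists>m t. sparse_partition (\<delta> / 2) (6 * e) (cadlag_fun x) 0 m t"
proof -
  obtain N where "1 / (\<delta> / 2) \<le> real N" using real_arch_simple by blast
  then have N: "1 - 0 \<le> real N * (\<delta> / 2)" using \<delta> by (simp add: field_simps)
  show ?thesis
  proof (rule regular_sparse_partition_from[OF x \<delta> _ _ N])
    show "\<bar>x s - x 0\<bar> \<le> 2 * e" if "s \<in> {0..0 + \<delta> / 2}" for s
      using regular_start[OF x \<delta>, of s] that \<delta> by auto
  qed (use \<delta> in auto)
qed

section \<open>Subsequences, partitions and time changes\<close>

lemma diagonal_convergent_subseq:
  fixes f :: "nat \<Rightarrow> 'b::countable \<Rightarrow> real"
  assumes bdd: "\<And>j. \<exists>B. \<forall>n. \<bar>f n j\<bar> \<le> B"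
  obtains r where "strict_mono (r :: nat \<Rightarrow> nat)" "\<And>j. convergent (\<lambda>n. f (r n) j)"
proof -
  let ?P = "\<lambda>j s. convergent (\<lambda>k. f (s k) (from_nat j :: 'b))"
  interpret subseqs ?P
  proof
    fix j and s :: "nat \<Rightarrow> nat"
    obtain B where "\<forall>n. \<bar>f n (from_nat j)\<bar> \<le> B" using bdd by blast
    then have "\<forall>k. f (s k) (from_nat j) \<in> {-B..B}" by (simp add: abs_le_iff minus_le_iff)
    moreover have "seq_compact {-B..B}" using compact_Icc by (rule compact_imp_seq_compact)
    ultimately obtain l r' where "strict_mono (r' :: nat \<Rightarrow> nat)" "((\<lambda>k. f (s k) (from_nat j)) \<circ> r') \<longlonglongrightarrow> l"
      by (elim seq_compactE[where f = "\<lambda>k. f (s k) (from_nat j)"]) auto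
    then show "\<exists>r'. strict_mono r' \<and> ?P j (s \<circ> r')" by (auto simp: convergent_def o_def)
  qed
  have diag: "?P j diagseq" for j
  proof -
    have "?P j (diagseq \<circ> (+) (Suc j))"
    proof (rule diagseq_holds)
      fix r s :: "nat \<Rightarrow> nat" and n
      assume "strict_mono r" "?P n s"
      then show "?P n (s \<circ> r)"
        using convergent_subseq_convergent[of "\<lambda>k. f (s k) (from_nat n)" r] by (simp add: o_def)
    qed
    then show ?thesis
      using convergent_ignore_initial_segment[of "\<lambda>n. f (diagseq n) (from_nat j)" "Suc j"]
      by (simp add: o_def add.commute)
  qed
  have "convergent (\<lambda>n. f (diagseq n) j)" for j using diag[of "to_nat j"] by simp
  with subseq_diagseq show ?thesis by (rule that)
qed

lemma convergent_of_nat_imp_eventually_const: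
  fixes m :: "nat \<Rightarrow> nat"
  assumes "convergent (\<lambda>n. real (m n))"
  shows "\<exists>c. eventually (\<lambda>n. m n = c) sequentially"
proof -
  obtain L where "(\<lambda>n. real (m n)) \<longlonglongrightarrow> L" using assms by (auto simp: convergent_def)
  then obtain N where N: "\<And>n. n \<ge> N \<Longrightarrow> \<bar>real (m n) - L\<bar> < 1 / 2"
    by (metis LIMSEQ_D half_gt_zero zero_less_one real_norm_def)
  have "m n = m N" if "n \<ge> N" for n
    using N[OF that] N[of N] by linarith
  then show ?thesis unfolding eventually_sequentially by blast
qed

lemma partition_locate_right:
  fixes t :: "nat \<Rightarrow> real"
  assumes "t 0 \<le> s" "s < t m"
  shows "\<exists>i<m. t i \<le> s \<and> s < t (Suc i)"
  using assms
proof (induction m)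
  case (Suc m)
  then show ?case by (cases "s < t m") (auto simp: less_Suc_eq)
qed simp

lemma partition_locate_left:
  fixes t :: "nat \<Rightarrow> real"
  assumes "t 0 < s" "s \<le> t m"
  shows "\<exists>i<m. t i < s \<and> s \<le> t (Suc i)"
  using assms
proof (induction m)
  case (Suc m)
  then show ?case by (cases "s \<le> t m") (auto simp: less_Suc_eq)
qed simp

lemma partition_gap:
  fixes t :: "nat \<Rightarrow> real"
  assumes "\<And>i. i < m \<Longrightarrow> t i + d \<le> t (Suc i)" "i \<le> j" "j \<le> m"
  shows "t i + real (j - i) * d \<le> t j"
  using assms(2,3)
proof (induction j rule: dec_induct)
  case (step j)
  then have "t i + real (j - i) * d \<le> t j" "t j + d \<le> t (Suc j)" using assms(1) by auto
  then show ?case using step by (simp add: Suc_diff_le algebra_simps)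
qed simp

text \<open>
  The piecewise linear time change is written as a sum of one truncated linear ramp per cell, from which
  continuity and monotonicity can be read off summand by summand. On the \<open>i\<close>-th cell the earlier ramps are
  complete and the later ones have not begun, so the sum telescopes there. The displacement is linear on
  each cell and hence bounded by its values at the division points.
\<close>

lemma time_change_between_partitions:
  fixes s t :: "nat \<Rightarrow> real"
  assumes s: "s 0 = 0" "s m = 1" "\<And>i. i < m \<Longrightarrow> s i < s (Suc i)"
    and t: "t 0 = 0" "t m = 1" "\<And>i. i < m \<Longrightarrow> t i < t (Suc i)"
    and close: "\<And>i. i \<le> m \<Longrightarrow> \<bar>s i - t i\<bar> \<le> \<eta>"
  obtains l where "l \<in> \<Lambda>"
    "\<And>i u. i < m \<Longrightarrow> u \<in> {s i..<s (Suc i)} \<Longrightarrow> l u \<in> {t i..<t (Suc i)}"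
    "\<And>u. u \<in> {0..1} \<Longrightarrow> \<bar>l u - u\<bar> \<le> \<eta>"
proof -
  define c where "c i u = max 0 (min 1 ((u - s i) / (s (Suc i) - s i)))" for i and u :: real
  define l where "l u = (\<Sum>i<m. (t (Suc i) - t i) * c i u)" for u
  have s_mono: "s i \<le> s j" if "i \<le> j" "j \<le> m" for i j
    using partition_gap[of m s 0 i j] s(3) that by (auto intro: less_imp_le)
  have c0: "c i u = 0" if "i < m" "u \<le> s i" for i u
    using s(3)[OF that(1)] that(2) unfolding c_def by (simp add: divide_nonpos_pos)
  have c1: "c i u = 1" if "i < m" "s (Suc i) \<le> u" for i u
  proof -
    have "1 \<le> (u - s i) / (s (Suc i) - s i)" using s(3)[OF that(1)] that(2) by (simp add: le_divide_eq)
    then show ?thesis unfolding c_def by simp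
  qed
  have c_in: "c i u = (u - s i) / (s (Suc i) - s i)" if "i < m" "s i \<le> u" "u \<le> s (Suc i)" for i u
  proof -
    have "0 \<le> (u - s i) / (s (Suc i) - s i)" "(u - s i) / (s (Suc i) - s i) \<le> 1"
      using s(3)[OF that(1)] that(2,3) by (auto simp: divide_le_eq)
    then show ?thesis unfolding c_def by simp
  qed
  have l_in: "l u = t i + (t (Suc i) - t i) * c i u" if i: "i < m" "s i \<le> u" "u \<le> s (Suc i)" for i u
  proof -
    have split: "{..<m} = {..<i} \<union> insert i {Suc i..<m}" using i(1) by auto
    have "l u = (\<Sum>j<i. (t (Suc j) - t j) * c j u) + ((t (Suc i) - t i) * c i u + (\<Sum>j=Suc i..<m. (t (Suc j) - t j) * c j u))"
      unfolding l_def split by (subst sum.union_disjoint) auto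
    also have "(\<Sum>j<i. (t (Suc j) - t j) * c j u) = (\<Sum>j<i. t (Suc j) - t j)"
    proof (rule sum.cong)
      fix j assume "j \<in> {..<i}"
      then have "s (Suc j) \<le> u" using s_mono[of "Suc j" i] i by simp
      then show "(t (Suc j) - t j) * c j u = t (Suc j) - t j" using c1[of j u] \<open>j \<in> {..<i}\<close> i by simp
    qed simp
    also have "\<dots> = t i" by (simp add: sum_lessThan_telescope t(1))
    also have "(\<Sum>j=Suc i..<m. (t (Suc j) - t j) * c j u) = 0"
    proof (rule sum.neutral, rule ballI)
      fix j assume "j \<in> {Suc i..<m}"
      then have "u \<le> s j" using s_mono[of "Suc i" j] i by simp
      then show "(t (Suc j) - t j) * c j u = 0" using c0[of j u] \<open>j \<in> {Suc i..<m}\<close> by simp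
    qed
    finally show ?thesis by simp
  qed
  have locate: "\<exists>i<m. s i \<le> u \<and> u < s (Suc i)" if "0 \<le> u" "u < 1" for u
    using partition_locate_right[of s u m] s(1,2) that by simp
  have l0: "l 0 = 0"
    unfolding l_def using c0[of _ 0] s_mono[of 0] s(1) by (intro sum.neutral) simp
  have "l 1 = (\<Sum>i<m. t (Suc i) - t i)"
    unfolding l_def using c1[of _ 1] s_mono[of _ m] s(2) by (intro sum.cong) simp_all
  then have l1: "l 1 = 1" by (simp add: sum_lessThan_telescope t(1,2))
  have l_strict: "l u < l v" if uv: "0 \<le> u" "u < v" "v \<le> 1" for u v
    unfolding l_def
  proof (rule sum_strict_mono_ex1)
    show "\<forall>i\<in>{..<m}. (t (Suc i) - t i) * c i u \<le> (t (Suc i) - t i) * c i v"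
    proof
      fix i assume "i \<in> {..<m}"
      then have i: "i < m" by simp
      have "(u - s i) / (s (Suc i) - s i) \<le> (v - s i) / (s (Suc i) - s i)"
        using s(3)[OF i] uv by (intro divide_right_mono) auto
      then have "c i u \<le> c i v" unfolding c_def by (intro max.mono min.mono order_refl)
      then show "(t (Suc i) - t i) * c i u \<le> (t (Suc i) - t i) * c i v"
        using t(3)[OF i] by (intro mult_left_mono) auto
    qed
    obtain i where i: "i < m" "s i \<le> u" "u < s (Suc i)" using locate[of u] uv by auto
    have "c i u < c i v"
    proof (cases "v \<le> s (Suc i)")
      case True
      then have "c i u = (u - s i) / (s (Suc i) - s i)" "c i v = (v - s i) / (s (Suc i) - s i)"
        using c_in[of i] i uv by auto
      then show ?thesis using s(3)[OF i(1)] uv by (simp add: divide_strict_right_mono)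
    next
      case False
      then have "c i v = 1" using c1[of i v] i by simp
      moreover have "c i u < 1" using c_in[of i u] i s(3)[OF i(1)] by (simp add: divide_less_eq)
      ultimately show ?thesis by simp
    qed
    then show "\<exists>i\<in>{..<m}. (t (Suc i) - t i) * c i u < (t (Suc i) - t i) * c i v"
      using i t(3)[OF i(1)] by (intro bexI[of _ i]) auto
  qed simp
  have l_mono: "l u \<le> l v" if "0 \<le> u" "u \<le> v" "v \<le> 1" for u v
    using l_strict[of u v] that by (cases "u = v") auto
  have "continuous_on {0..1} l"
    unfolding l_def c_def by (intro continuous_intros) (use s(3) in force)
  moreover have "l \<in> {0..1} \<rightarrow> {0..1}" using l_mono[of 0] l_mono[of _ 1] l0 l1 by auto
  moreover have "strict_mono_on {0..1} l" using l_strict by (auto simp: strict_mono_on_def)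
  ultimately have "l \<in> \<Lambda>" using l0 l1 by (simp add: time_changes_def)
  moreover have "l u \<in> {t i..<t (Suc i)}" if i: "i < m" and u: "u \<in> {s i..<s (Suc i)}" for i u
  proof -
    have "0 \<le> c i u" "c i u < 1"
      using c_in[of i u] i u s(3)[OF i] by (auto simp: divide_less_eq)
    moreover have gap: "0 < t (Suc i) - t i" using t(3)[OF i] by simp
    ultimately have "0 \<le> (t (Suc i) - t i) * c i u" "(t (Suc i) - t i) * c i u < t (Suc i) - t i"
      by (simp_all add: mult_less_cancel_left1)
    moreover have "l u = t i + (t (Suc i) - t i) * c i u" using l_in[of i u] i u by simp
    ultimately show ?thesis by (simp del: mult_less_cancel_left1 mult_less_cancel_left2)
  qed
  moreover have "\<bar>l u - u\<bar> \<le> \<eta>" if u: "u \<in> {0..1}" for u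
  proof (cases "u = 1")
    case True
    then show ?thesis using l1 close[of 0] s t by simp
  next
    case False
    then obtain i where i: "i < m" "s i \<le> u" "u < s (Suc i)" using locate[of u] u by auto
    define \<theta> where "\<theta> = c i u"
    have ne: "s (Suc i) - s i \<noteq> 0" using s(3)[OF i(1)] by simp
    have \<theta>_eq: "\<theta> = (u - s i) / (s (Suc i) - s i)" using c_in[of i u] i by (simp add: \<theta>_def)
    then have \<theta>: "0 \<le> \<theta>" "\<theta> \<le> 1" using i by (auto simp: divide_le_eq)
    have "\<theta> * (s (Suc i) - s i) = u - s i" using ne unfolding \<theta>_eq by simp
    moreover have "l u = t i + (t (Suc i) - t i) * \<theta>" using l_in[of i u] i by (simp add: \<theta>_def)
    ultimately have eq: "l u - u = (1 - \<theta>) * (t i - s i) + \<theta> * (t (Suc i) - s (Suc i))"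
      by (simp add: algebra_simps)
    have "\<bar>l u - u\<bar> \<le> (1 - \<theta>) * \<bar>t i - s i\<bar> + \<theta> * \<bar>t (Suc i) - s (Suc i)\<bar>"
      unfolding eq using \<theta> by (intro order_trans[OF abs_triangle_ineq]) (simp add: abs_mult)
    also have "\<dots> \<le> (1 - \<theta>) * \<eta> + \<theta> * \<eta>"
      using close[of i] close[of "Suc i"] i \<theta>
      by (intro add_mono mult_left_mono) (auto simp: abs_minus_commute)
    finally show ?thesis by (simp add: algebra_simps)
  qed
  ultimately show ?thesis by (rule that)
qed

text \<open>
  The condition on the left names no candidate for the left limit. It says that the values form a Cauchy
  filter as \<open>t\<close> is approached from below, so the limit exists by completeness of the reals.
\<close>

lemma cadlag_of_nearly_constant:
  assumes right: "\<And>t e. 0 \<le> t \<Longrightarrow> t < 1 \<Longrightarrow> e > 0 \<Longrightarrow> \<exists>h>t. h \<le> 1 \<and> (\<forall>s\<in>{t<..<h}. \<bar>f s - f t\<bar> < e)"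
    and left: "\<And>t e. 0 < t \<Longrightarrow> t \<le> 1 \<Longrightarrow> e > 0 \<Longrightarrow> \<exists>h<t. 0 \<le> h \<and> (\<exists>c. \<forall>s\<in>{h<..<t}. \<bar>f s - c\<bar> < e)"
  obtains y :: skorokhod where "\<And>t. t \<in> {0..1} \<Longrightarrow> y t = f t"
proof -
  define g where "g = restrict f {0..1}"
  have "cadlag_on_unit g"
    unfolding cadlag_on_unit_def
  proof (intro conjI ballI)
    fix t :: real assume "t \<in> {0..<1}"
    then have t: "0 \<le> t" "t < 1" by auto
    show "(g \<longlongrightarrow> g t) (at_right t)"
    proof (rule tendstoI)
      fix e :: real assume "e > 0"
      then obtain h where h: "t < h" "h \<le> 1" "\<forall>s\<in>{t<..<h}. \<bar>f s - f t\<bar> < e" using right[OF t] by blast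
      then show "eventually (\<lambda>s. dist (g s) (g t) < e) (at_right t)"
        using t unfolding eventually_at_right[OF t(2)]
        by (intro exI[of _ h]) (auto simp: g_def dist_real_def)
    qed
  next
    fix t :: real assume "t \<in> {0<..1}"
    then have t: "0 < t" "t \<le> 1" by auto
    have "cauchy_filter (filtermap g (at_left t))"
      unfolding cauchy_filter_metric_filtermap
    proof (intro allI impI)
      fix e :: real assume "e > 0"
      then obtain h c where h: "h < t" "0 \<le> h" "\<forall>s\<in>{h<..<t}. \<bar>f s - c\<bar> < e / 2" using left[OF t, of "e / 2"] by auto
      have "dist (g u) (g v) < e" if "u \<in> {h<..<t}" "v \<in> {h<..<t}" for u v
      proof -
        have "\<bar>f u - c\<bar> < e / 2" "\<bar>f v - c\<bar> < e / 2" using h that by blast+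
        moreover have "g u = f u" "g v = f v" using h t that by (auto simp: g_def)
        ultimately show ?thesis unfolding dist_real_def by linarith
      qed
      moreover have "eventually (\<lambda>s. s \<in> {h<..<t}) (at_left t)"
        using h(1) by (auto simp: eventually_at_left[OF t(1)])
      ultimately show "\<exists>P. eventually P (at_left t) \<and> (\<forall>u v. P u \<and> P v \<longrightarrow> dist (g u) (g v) < e)" by blast
    qed
    then obtain l where "filtermap g (at_left t) \<le> nhds l"
      using cauchy_filter_complete_converges[OF _ complete_UNIV, of "filtermap g (at_left t)"]
      by (auto simp: filtermap_bot_iff)
    then show "\<exists>l. (g \<longlongrightarrow> l) (at_left t)" by (auto simp: filterlim_def)
  qed
  then have "cadlag_fun (Abs_skorokhod g) = g"
    by (intro Abs_skorokhod_inverse) (simp add: g_def)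
  then show ?thesis by (intro that[of "Abs_skorokhod g"]) (simp add: g_def)
qed

section \<open>Compactness from uniform sparse partitions\<close>

lemma sparse_partition_unit_bounds:
  assumes "sparse_partition d e f 0 m t" "d > 0"
  shows "i \<le> m \<Longrightarrow> t i \<in> {0..1}" "real m * d \<le> 1"
proof -
  have *: "t i + real (j - i) * d \<le> t j" if "i \<le> j" "j \<le> m" for i j
    using partition_gap[of m t d i j] assms(1) that by (auto simp: sparse_partition_def)
  have 01: "t 0 = 0" "t m = 1" using assms(1) by (auto simp: sparse_partition_def)
  show "real m * d \<le> 1" using *[of 0 m] 01 by simp
  show "t i \<in> {0..1}" if i: "i \<le> m"
  proof -
    have "0 \<le> real i * d" "0 \<le> real (m - i) * d" using assms(2) by simp_all
    then show ?thesis using *[of 0 i] *[of i m] i 01 by simp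
  qed
qed

text \<open>
  At scale \<open>k\<close> a path is described by the number of cells, the division points and the values there. All of
  these are bounded, the number of cells because each has length at least \<open>d k\<close>. So one subsequence
  makes all of them converge at all scales, and a convergent number of cells is eventually a constant \<open>\<mu> k\<close>.
\<close>

lemma sparse_partitions_subseq_limits:
  fixes x :: "nat \<Rightarrow> skorokhod"
  assumes bdd: "\<And>n. unif_norm (x n) \<le> B" and d: "\<And>k. d k > 0"
    and part: "\<And>n k. \<exists>m t. sparse_partition (d k) (e k) (x n) 0 m t"
  obtains r :: "nat \<Rightarrow> nat" and \<mu> and T :: "nat \<Rightarrow> nat \<Rightarrow> nat \<Rightarrow> real" and \<tau> \<alpha> where
    "strict_mono r"
    "\<And>k. eventually (\<lambda>n. sparse_partition (d k) (e k) (x (r n)) 0 (\<mu> k) (T n k)) sequentially"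
    "\<And>k i. i \<le> \<mu> k \<Longrightarrow> (\<lambda>n. T n k i) \<longlonglongrightarrow> \<tau> k i"
    "\<And>k i. i \<le> \<mu> k \<Longrightarrow> (\<lambda>n. x (r n) (T n k i)) \<longlonglongrightarrow> \<alpha> k i"
proof -
  define p where "p n k = (SOME p. sparse_partition (d k) (e k) (x n) 0 (fst p) (snd p))" for n k
  define m t where "m n k = fst (p n k)" and "t n k = snd (p n k)" for n k
  have mt: "sparse_partition (d k) (e k) (x n) 0 (m n k) (t n k)" for n k
    unfolding m_def t_def p_def by (rule someI_ex) (use part[of k n] in simp)
  \<comment> \<open>Indices beyond the last division point are folded back to it, which keeps all entries bounded.\<close>
  define g where "g n = (\<lambda>(k, i, c). if c = 0 then real (m n k)
    else if c = Suc 0 then t n k (min i (m n k)) else cadlag_fun (x n) (t n k (min i (m n k))))" for n and j :: "nat \<times> nat \<times> nat"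
  have t01: "t n k (min i (m n k)) \<in> {0..1}" for n k i
    using sparse_partition_unit_bounds(1)[OF mt d] by simp
  have "\<exists>B. \<forall>n. \<bar>g n j\<bar> \<le> B" for j
  proof -
    obtain k i c where j: "j = (k, i, c)" by (cases j) auto
    have "\<bar>g n j\<bar> \<le> max (1 / d k) (max 1 B)" for n
    proof -
      have "real (m n k) \<le> 1 / d k"
        using sparse_partition_unit_bounds(2)[OF mt d, of n k] d[of k] by (simp add: le_divide_eq)
      moreover have "\<bar>x n (t n k (min i (m n k)))\<bar> \<le> B"
        using unif_norm_abs_le[OF t01[of n k i], of "x n"] bdd[of n] by linarith
      ultimately show ?thesis using t01[of n k i] unfolding j g_def by auto
    qed
    then show ?thesis by blast
  qed
  then obtain r where r: "strict_mono (r :: nat \<Rightarrow> nat)" and conv: "\<And>j. convergent (\<lambda>n. g (r n) j)"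
    using diagonal_convergent_subseq[of g] by blast
  have "\<exists>c. eventually (\<lambda>n. m (r n) k = c) sequentially" for k
    using conv[of "(k, 0, 0)"] by (intro convergent_of_nat_imp_eventually_const) (simp add: g_def)
  then obtain \<mu> where \<mu>: "\<And>k. eventually (\<lambda>n. m (r n) k = \<mu> k) sequentially" by metis
  show ?thesis
  proof (rule that[of r \<mu> "\<lambda>n k. t (r n) k" "\<lambda>k i. lim (\<lambda>n. g (r n) (k, i, 1))" "\<lambda>k i. lim (\<lambda>n. g (r n) (k, i, 2))"])
    show "eventually (\<lambda>n. sparse_partition (d k) (e k) (x (r n)) 0 (\<mu> k) (t (r n) k)) sequentially" for k
      using \<mu>[of k] by eventually_elim (use mt in metis)
  next
    fix k i assume i: "i \<le> \<mu> k"
    have "(\<lambda>n. g (r n) (k, i, c)) \<longlonglongrightarrow> lim (\<lambda>n. g (r n) (k, i, c))" for c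
      using conv by (simp add: convergent_LIMSEQ_iff)
    moreover have "eventually (\<lambda>n. g (r n) (k, i, 1) = t (r n) k i) sequentially"
      "eventually (\<lambda>n. g (r n) (k, i, 2) = x (r n) (t (r n) k i)) sequentially"
      using \<mu>[of k] by (eventually_elim, use i in \<open>simp add: g_def\<close>)+
    ultimately show "(\<lambda>n. t (r n) k i) \<longlonglongrightarrow> lim (\<lambda>n. g (r n) (k, i, 1))"
      "(\<lambda>n. x (r n) (t (r n) k i)) \<longlonglongrightarrow> lim (\<lambda>n. g (r n) (k, i, 2))"
      by (blast intro: Lim_transform_eventually)+
  qed (rule r)
qed

text \<open>
  The limiting step functions at scales \<open>k\<close> and \<open>l\<close> differ by at most \<open>e k + e l\<close>: a time in the
  interior of a cell of both is, for large \<open>n\<close>, in the corresponding two cells of the \<open>n\<close>-th path. Hence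
  they converge uniformly, to a cadlag function, and the piecewise linear time changes that match the
  partitions carry the paths to this limit.
\<close>

lemma sparse_partitions_convergent_subseq:
  fixes x :: "nat \<Rightarrow> skorokhod"
  assumes bdd: "\<And>n. unif_norm (x n) \<le> B" and d: "\<And>k. d k > 0" and e: "e \<longlonglongrightarrow> 0"
    and part: "\<And>n k. \<exists>m t. sparse_partition (d k) (e k) (x n) 0 m t"
  obtains r y where "strict_mono (r :: nat \<Rightarrow> nat)" "(\<lambda>n. x (r n)) \<longlonglongrightarrow> y"
proof -
  obtain r :: "nat \<Rightarrow> nat" and \<mu> and T :: "nat \<Rightarrow> nat \<Rightarrow> nat \<Rightarrow> real" and \<tau> \<alpha> where r: "strict_mono r"
    and P: "\<And>k. eventually (\<lambda>n. sparse_partition (d k) (e k) (x (r n)) 0 (\<mu> k) (T n k)) sequentially"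
    and \<tau>: "\<And>k i. i \<le> \<mu> k \<Longrightarrow> (\<lambda>n. T n k i) \<longlonglongrightarrow> \<tau> k i"
    and \<alpha>: "\<And>k i. i \<le> \<mu> k \<Longrightarrow> (\<lambda>n. x (r n) (T n k i)) \<longlonglongrightarrow> \<alpha> k i"
    by (rule sparse_partitions_subseq_limits[of x B d e, OF bdd d part]) (rule that)
  define X where "X n = x (r n)" for n
  note P = P[folded X_def] and \<alpha> = \<alpha>[folded X_def]
  have ev_const: "c = c'" if "f \<longlonglongrightarrow> c'" "eventually (\<lambda>n. f n = c) sequentially" for f :: "nat \<Rightarrow> real" and c c'
    using LIMSEQ_unique[OF tendsto_eventually[OF that(2)] that(1)] .
  have \<tau>0: "\<tau> k 0 = 0" for k
  proof -
    have "eventually (\<lambda>n. T n k 0 = 0) sequentially"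
      using P[of k] by eventually_elim (simp add: sparse_partition_def)
    with \<tau>[of 0 k] show ?thesis by (intro ev_const[symmetric]) simp_all
  qed
  have T1: "eventually (\<lambda>n. T n k (\<mu> k) = 1) sequentially" for k
    using P[of k] by eventually_elim (simp add: sparse_partition_def)
  then have \<tau>1: "\<tau> k (\<mu> k) = 1" for k
    using \<tau>[of "\<mu> k" k] by (intro ev_const[symmetric]) simp_all
  have \<tau>_gap: "\<tau> k i < \<tau> k (Suc i)" if i: "i < \<mu> k" for k i
  proof -
    have "eventually (\<lambda>n. T n k i + d k \<le> T n k (Suc i)) sequentially"
      using P[of k] by eventually_elim (use i in \<open>simp add: sparse_partition_def\<close>)
    then have "\<tau> k i + d k \<le> \<tau> k (Suc i)"
      using i by (intro tendsto_le[OF sequentially_bot \<tau> tendsto_add[OF \<tau> tendsto_const]]) auto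
    then show ?thesis using d[of k] by simp
  qed
  have \<tau>01: "0 \<le> \<tau> k i" "\<tau> k i \<le> 1" if "i \<le> \<mu> k" for k i
    using partition_gap[of "\<mu> k" "\<tau> k" 0 0 i] partition_gap[of "\<mu> k" "\<tau> k" 0 i "\<mu> k"]
      \<tau>_gap \<tau>0[of k] \<tau>1[of k] that by (auto intro: less_imp_le)
  \<comment> \<open>The limiting step functions at two scales are compared at a time \<open>u\<close> interior to a cell of each.\<close>
  have agree: "\<bar>\<alpha> k i - \<alpha> l j\<bar> \<le> e k + e l"
    if i: "i < \<mu> k" and j: "j < \<mu> l" and s: "s \<in> {\<tau> k i..<\<tau> k (Suc i)}" "s \<in> {\<tau> l j..<\<tau> l (Suc j)}" for k l i j s
  proof -
    have "s < min (\<tau> k (Suc i)) (\<tau> l (Suc j))" using s by simp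
    then obtain u where u: "s < u" "u < \<tau> k (Suc i)" "u < \<tau> l (Suc j)" using dense by (metis min_less_iff_conj)
    have cell: "eventually (\<lambda>n. \<bar>X n u - X n (T n k' i')\<bar> \<le> e k') sequentially"
      if i': "i' < \<mu> k'" "\<tau> k' i' < u" "u < \<tau> k' (Suc i')" for k' i'
    proof -
      have "eventually (\<lambda>n. T n k' i' < u) sequentially" "eventually (\<lambda>n. u < T n k' (Suc i')) sequentially"
        using order_tendstoD[OF \<tau>] i' by auto
      with P[of k'] show ?thesis
        by eventually_elim (use i'(1) in \<open>auto simp: sparse_partition_def\<close>)
    qed
    have "eventually (\<lambda>n. \<bar>X n u - X n (T n k i)\<bar> \<le> e k) sequentially"
      "eventually (\<lambda>n. \<bar>X n u - X n (T n l j)\<bar> \<le> e l) sequentially"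
      using u s by (auto intro: cell[OF i] cell[OF j])
    then have "eventually (\<lambda>n. \<bar>X n (T n k i) - X n (T n l j)\<bar> \<le> e k + e l) sequentially"
      by eventually_elim linarith
    moreover have "(\<lambda>n. \<bar>X n (T n k i) - X n (T n l j)\<bar>) \<longlonglongrightarrow> \<bar>\<alpha> k i - \<alpha> l j\<bar>"
      using i j by (intro tendsto_intros \<alpha>) auto
    ultimately show ?thesis by (intro tendsto_upperbound) auto
  qed
  have "\<forall>k s. \<exists>i. 0 \<le> s \<longrightarrow> s < 1 \<longrightarrow> i < \<mu> k \<and> s \<in> {\<tau> k i..<\<tau> k (Suc i)}"
  proof (intro allI)
    fix k s
    show "\<exists>i. 0 \<le> s \<longrightarrow> s < 1 \<longrightarrow> i < \<mu> k \<and> s \<in> {\<tau> k i..<\<tau> k (Suc i)}"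
      using partition_locate_right[of "\<tau> k" s "\<mu> k"] \<tau>0[of k] \<tau>1[of k] by fastforce
  qed
  then obtain idx where idx: "\<And>k s. 0 \<le> s \<Longrightarrow> s < 1 \<Longrightarrow> idx k s < \<mu> k"
    "\<And>k s. 0 \<le> s \<Longrightarrow> s < 1 \<Longrightarrow> s \<in> {\<tau> k (idx k s)..<\<tau> k (Suc (idx k s))}" by metis
  define z where "z k s = \<alpha> k (idx k s)" for k s
  have e0: "e k \<ge> 0" for k
  proof -
    have "0 < \<mu> k" using \<tau>0[of k] \<tau>1[of k] by (cases "\<mu> k") auto
    then have "\<bar>\<alpha> k 0 - \<alpha> k 0\<bar> \<le> e k + e k" using \<tau>_gap[of 0 k] by (intro agree[of 0 k 0 k "\<tau> k 0"]) auto
    then show ?thesis by simp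
  qed
  have e_small: "\<exists>K. \<forall>k\<ge>K. e k < \<epsilon>" if "\<epsilon> > 0" for \<epsilon>
    using order_tendstoD(2)[OF e that] by (simp add: eventually_sequentially)
  have z_lim: "(\<lambda>k. z k s) \<longlonglongrightarrow> lim (\<lambda>k. z k s)" if s: "0 \<le> s" "s < 1" for s
  proof -
    have "Cauchy (\<lambda>k. z k s)"
    proof (rule metric_CauchyI)
      fix \<epsilon> :: real assume "\<epsilon> > 0"
      then obtain K where K: "\<And>k. k \<ge> K \<Longrightarrow> e k < \<epsilon> / 2" using e_small[of "\<epsilon> / 2"] by auto
      have "dist (z k s) (z l s) < \<epsilon>" if "k \<ge> K" "l \<ge> K" for k l
      proof -
        have "\<bar>z k s - z l s\<bar> \<le> e k + e l" unfolding z_def by (rule agree) (use idx s in blast)+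
        then show ?thesis using K[OF that(1)] K[OF that(2)] by (simp add: dist_real_def)
      qed
      then show "\<exists>M. \<forall>m\<ge>M. \<forall>n\<ge>M. dist (z m s) (z n s) < \<epsilon>" by blast
    qed
    then show ?thesis by (simp add: Cauchy_convergent_iff convergent_LIMSEQ_iff)
  qed
  define f where "f s = (if s < 1 then lim (\<lambda>k. z k s) else \<alpha> 0 (\<mu> 0))" for s
  \<comment> \<open>The comparison of scales \<open>k\<close> and \<open>l\<close>, with \<open>l\<close> tending to infinity.\<close>
  have f_near: "\<bar>\<alpha> k i - f s\<bar> \<le> e k" if i: "i < \<mu> k" and s: "s \<in> {\<tau> k i..<\<tau> k (Suc i)}" for k i s
  proof -
    have s01: "0 \<le> s" "s < 1" using \<tau>01[of i k] \<tau>01[of "Suc i" k] i s by auto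
    have "(\<lambda>l. \<bar>\<alpha> k i - z l s\<bar>) \<longlonglongrightarrow> \<bar>\<alpha> k i - f s\<bar>"
      using z_lim[OF s01] s01 by (intro tendsto_intros) (simp add: f_def)
    moreover have "(\<lambda>l. e k + e l) \<longlonglongrightarrow> e k + 0" by (intro tendsto_intros e)
    moreover have "\<bar>\<alpha> k i - z l s\<bar> \<le> e k + e l" for l
      unfolding z_def by (rule agree[OF i _ s]) (use idx s01 in blast)+
    ultimately show ?thesis by (intro tendsto_le[OF sequentially_bot, of "\<lambda>l. e k + e l" _ "\<lambda>l. \<bar>\<alpha> k i - z l s\<bar>"]) auto
  qed
  have X1: "(\<lambda>n. X n 1) \<longlonglongrightarrow> \<alpha> k (\<mu> k)" for k
  proof (rule Lim_transform_eventually[OF \<alpha>])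
    show "eventually (\<lambda>n. X n (T n k (\<mu> k)) = X n 1) sequentially" using T1[of k] by eventually_elim simp
  qed simp
  obtain y :: skorokhod where y: "\<And>t. t \<in> {0..1} \<Longrightarrow> y t = f t"
  proof (rule cadlag_of_nearly_constant[of f])
    fix t \<epsilon> :: real assume t: "0 \<le> t" "t < 1" and "\<epsilon> > 0"
    then obtain k where k: "e k < \<epsilon> / 2" using e_small[of "\<epsilon> / 2"] by auto
    define i where "i = idx k t"
    have i: "i < \<mu> k" "t \<in> {\<tau> k i..<\<tau> k (Suc i)}" using idx t unfolding i_def by blast+
    show "\<exists>h>t. h \<le> 1 \<and> (\<forall>s\<in>{t<..<h}. \<bar>f s - f t\<bar> < \<epsilon>)"
    proof (intro exI[of _ "\<tau> k (Suc i)"] conjI ballI)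
      fix s assume "s \<in> {t<..<\<tau> k (Suc i)}"
      then show "\<bar>f s - f t\<bar> < \<epsilon>" using f_near[OF i(1), of s] f_near[OF i] i k by auto
    qed (use i \<tau>01[of "Suc i" k] in auto)
  next
    fix t \<epsilon> :: real assume t: "0 < t" "t \<le> 1" and "\<epsilon> > 0"
    then obtain k where k: "e k < \<epsilon>" using e_small[of \<epsilon>] by auto
    obtain i where i: "i < \<mu> k" "\<tau> k i < t" "t \<le> \<tau> k (Suc i)"
      using partition_locate_left[of "\<tau> k" t "\<mu> k"] \<tau>0 \<tau>1 t by auto
    have "\<forall>s\<in>{\<tau> k i<..<t}. \<bar>f s - \<alpha> k i\<bar> < \<epsilon>"
    proof
      fix s assume "s \<in> {\<tau> k i<..<t}"
      then show "\<bar>f s - \<alpha> k i\<bar> < \<epsilon>" using f_near[OF i(1), of s] i k by auto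
    qed
    moreover have "0 \<le> \<tau> k i" using \<tau>01[of i k] i by simp
    ultimately show "\<exists>h<t. 0 \<le> h \<and> (\<exists>c. \<forall>s\<in>{h<..<t}. \<bar>f s - c\<bar> < \<epsilon>)" using i(2) by blast
  qed (rule that)
  have "X \<longlonglongrightarrow> y"
  proof (rule metric_LIMSEQ_I)
    fix \<epsilon> :: real assume \<epsilon>: "\<epsilon> > 0"
    define \<eta> where "\<eta> = \<epsilon> / 4"
    have \<eta>: "\<eta> > 0" "4 * \<eta> = \<epsilon>" using \<epsilon> by (auto simp: \<eta>_def)
    obtain k where k: "e k < \<eta>" using e_small[OF \<eta>(1)] by auto
    have "eventually (\<lambda>n. \<forall>i\<in>{..\<mu> k}. \<bar>T n k i - \<tau> k i\<bar> < \<eta> \<and> \<bar>X n (T n k i) - \<alpha> k i\<bar> < \<eta>) sequentially"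
    proof (rule eventually_ball_finite)
      show "\<forall>i\<in>{..\<mu> k}. eventually (\<lambda>n. \<bar>T n k i - \<tau> k i\<bar> < \<eta> \<and> \<bar>X n (T n k i) - \<alpha> k i\<bar> < \<eta>) sequentially"
      proof
        fix i assume "i \<in> {..\<mu> k}"
        then have i: "i \<le> \<mu> k" by simp
        show "eventually (\<lambda>n. \<bar>T n k i - \<tau> k i\<bar> < \<eta> \<and> \<bar>X n (T n k i) - \<alpha> k i\<bar> < \<eta>) sequentially"
          using tendstoD[OF \<tau>[OF i] \<eta>(1)] tendstoD[OF \<alpha>[OF i] \<eta>(1)]
          by eventually_elim (simp add: dist_real_def)
      qed
    qed simp
    with P[of k] have "eventually (\<lambda>n. dist (X n) y < \<epsilon>) sequentially"
    proof eventually_elim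
      case (elim n)
      let ?m = "\<mu> k" and ?t = "T n k"
      have t01: "?t 0 = 0" "?t ?m = 1" and t_gap: "\<And>i. i < ?m \<Longrightarrow> ?t i < ?t (Suc i)"
        and osc: "\<And>i s. i < ?m \<Longrightarrow> s \<in> {?t i..<?t (Suc i)} \<Longrightarrow> \<bar>X n s - X n (?t i)\<bar> \<le> e k"
        using elim(1) d[of k] by (auto simp: sparse_partition_def intro: less_le_trans[of _ "_ + d k"])
      have near: "\<bar>?t i - \<tau> k i\<bar> < \<eta>" "\<bar>X n (?t i) - \<alpha> k i\<bar> < \<eta>" if "i \<le> ?m" for i
        using elim(2) that by auto
      obtain l where l: "l \<in> \<Lambda>"
        and cell: "\<And>i u. i < ?m \<Longrightarrow> u \<in> {?t i..<?t (Suc i)} \<Longrightarrow> l u \<in> {\<tau> k i..<\<tau> k (Suc i)}"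
        and small: "\<And>u. u \<in> {0..1} \<Longrightarrow> \<bar>l u - u\<bar> \<le> \<eta>"
        using time_change_between_partitions[OF t01 t_gap \<tau>0 \<tau>1 \<tau>_gap less_imp_le[OF near(1)]] by blast
      have "dist (X n) y \<le> 3 * \<eta>"
      proof (rule dist_skorokhod_leI[OF l])
        fix u :: real assume u: "u \<in> {0..1}"
        show "\<bar>l u - u\<bar> \<le> 3 * \<eta>" using small[OF u] \<eta> by simp
        show "\<bar>X n u - y (l u)\<bar> \<le> 3 * \<eta>"
        proof (cases "u = 1")
          case True
          then have "l u = 1" using l by (simp add: time_changes_def)
          moreover have "y 1 = \<alpha> k ?m" using y[of 1] LIMSEQ_unique[OF X1[of 0] X1[of k]] by (simp add: f_def)
          ultimately show ?thesis using near(2)[of ?m] t01 True \<eta> by simp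
        next
          case False
          then obtain i where i: "i < ?m" "?t i \<le> u" "u < ?t (Suc i)"
            using partition_locate_right[of ?t u ?m] t01 u by auto
          have "y (l u) = f (l u)" using time_change_range[OF l u] by (rule y)
          moreover have "\<bar>\<alpha> k i - f (l u)\<bar> \<le> e k" using i by (intro f_near cell) auto
          moreover have "\<bar>X n u - X n (?t i)\<bar> \<le> e k" using i by (intro osc) auto
          ultimately show ?thesis using near(2)[of i] i(1) k \<eta> by linarith
        qed
      qed
      then show ?case using \<eta> by simp
    qed
    then show "\<exists>N. \<forall>n\<ge>N. dist (X n) y < \<epsilon>" by (simp add: eventually_sequentially)
  qed
  then show ?thesis using r by (intro that[of r y]) (simp_all add: X_def[abs_def])
qed

lemma compact_closure_sparse_partitions:
  fixes A :: "skorokhod set"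
  assumes bdd: "\<And>x. x \<in> A \<Longrightarrow> unif_norm x \<le> B" and d: "\<And>k. d k > 0" and e: "e \<longlonglongrightarrow> 0"
    and part: "\<And>x k. x \<in> A \<Longrightarrow> \<exists>m t. sparse_partition (d k) (e k) x 0 m t"
  shows "compact (closure A)"
  unfolding compact_def
proof (intro allI impI)
  fix w :: "nat \<Rightarrow> skorokhod" assume w: "\<forall>n. w n \<in> closure A"
  have "\<exists>a\<in>A. dist a (w n) < inverse (real (Suc n))" for n
    using w closure_approachable[of "w n" A] by simp
  then obtain a where a: "\<And>n. a n \<in> A" "\<And>n. dist (a n) (w n) < inverse (real (Suc n))" by metis
  obtain r y where r: "strict_mono (r :: nat \<Rightarrow> nat)" and y: "(\<lambda>n. a (r n)) \<longlonglongrightarrow> y"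
    using sparse_partitions_convergent_subseq[of a B d e, OF bdd[OF a(1)] d e part[OF a(1)]] by blast
  have "(\<lambda>n. dist (a n) (w n)) \<longlonglongrightarrow> 0"
    by (rule real_tendsto_sandwich[OF _ _ tendsto_const LIMSEQ_inverse_real_of_nat])
      (use a(2) in \<open>auto intro!: always_eventually less_imp_le\<close>)
  then have aw: "(\<lambda>n. dist (a (r n)) (w (r n))) \<longlonglongrightarrow> 0"
    using LIMSEQ_subseq_LIMSEQ[OF _ r] by (simp add: o_def)
  have "(\<lambda>n. w (r n)) \<longlonglongrightarrow> y"
  proof (rule iffD2[OF tendsto_dist_iff], rule real_tendsto_sandwich[OF _ _ tendsto_const])
    show "(\<lambda>n. dist (a (r n)) (w (r n)) + dist (a (r n)) y) \<longlonglongrightarrow> 0"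
      using tendsto_add[OF aw iffD1[OF tendsto_dist_iff y]] by simp
    show "eventually (\<lambda>n. dist (w (r n)) y \<le> dist (a (r n)) (w (r n)) + dist (a (r n)) y) sequentially"
      by (intro always_eventually allI) (metis dist_commute dist_triangle)
  qed simp
  moreover have "y \<in> closure A"
    using y a(1) unfolding closure_sequential by (intro exI[of _ "\<lambda>n. a (r n)"]) simp
  ultimately show "\<exists>l\<in>closure A. \<exists>r. strict_mono r \<and> (w \<circ> r) \<longlonglongrightarrow> l"
    using r by (intro bexI[of _ y] exI[of _ r]) (simp_all add: o_def)
qed

section \<open>Tightness\<close>

text \<open>
  The events need not be monotone, so continuity from above is applied to the unions of the tails of
  their complements, which decrease to the empty set.
\<close>

lemma (in prob_space) eventually_in_imp_prob_compl_small:
  assumes meas: "\<And>j. F j \<in> events"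
    and ev: "\<And>x. x \<in> space M \<Longrightarrow> eventually (\<lambda>j. x \<in> F j) sequentially"
    and \<eta>: "\<eta> > 0"
  shows "\<exists>j. prob (space M - F j) < \<eta>"
proof -
  define G where "G j = (\<Union>i\<in>{j..}. space M - F i)" for j
  have "(\<lambda>j. prob (G j)) \<longlonglongrightarrow> prob (\<Inter>j. G j)"
    using meas by (intro finite_Lim_measure_decseq) (auto simp: G_def decseq_def)
  moreover have "(\<Inter>j. G j) = {}"
    using ev unfolding G_def eventually_sequentially by fastforce
  ultimately have "eventually (\<lambda>j. prob (G j) < \<eta>) sequentially"
    using order_tendstoD(2)[of "\<lambda>j. prob (G j)" 0 sequentially \<eta>] \<eta> by simp
  then obtain j where "prob (G j) < \<eta>" by (auto simp: eventually_sequentially)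
  moreover have "prob (space M - F j) \<le> prob (G j)"
    using meas by (intro finite_measure_mono) (auto simp: G_def)
  ultimately show ?thesis by (intro exI[of _ j]) simp
qed

lemma compact_unif_norm_bounded:
  assumes "compact (K :: skorokhod set)"
  obtains B where "\<And>x. x \<in> K \<Longrightarrow> unif_norm x \<le> B"
proof -
  obtain a b where "\<And>y. y \<in> K \<Longrightarrow> dist a y \<le> b"
    using compact_imp_bounded[OF assms] unfolding bounded_def by blast
  then have "unif_norm y \<le> unif_norm a + b" if "y \<in> K" for y
    using unif_norm_le_add_dist[of y a] that by (force simp: dist_commute)
  then show ?thesis by (rule that)
qed

lemma compact_uniformly_regular:
  assumes "compact K" "e > 0"
  obtains \<delta>0 where "\<delta>0 > 0" "\<And>\<delta>. 0 < \<delta> \<Longrightarrow> \<delta> \<le> \<delta>0 \<Longrightarrow> K \<subseteq> regular \<delta> e"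
proof -
  have "\<forall>x. \<exists>r>0. \<exists>\<delta>0>0. \<forall>y \<delta>. dist y x < r \<longrightarrow> 0 < \<delta> \<longrightarrow> \<delta> \<le> \<delta>0 \<longrightarrow> y \<in> regular \<delta> e"
  proof
    fix x
    obtain r \<delta>0 where "r > 0" "\<delta>0 > 0" "\<And>y \<delta>. dist y x < r \<Longrightarrow> 0 < \<delta> \<Longrightarrow> \<delta> \<le> \<delta>0 \<Longrightarrow> y \<in> regular \<delta> e"
      by (rule regular_near[OF assms(2), of x]) blast
    then show "\<exists>r>0. \<exists>\<delta>0>0. \<forall>y \<delta>. dist y x < r \<longrightarrow> 0 < \<delta> \<longrightarrow> \<delta> \<le> \<delta>0 \<longrightarrow> y \<in> regular \<delta> e" by blast
  qed
  then obtain r where r: "\<And>x. r x > 0"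
    and "\<forall>x. \<exists>\<delta>0>0. \<forall>y \<delta>. dist y x < r x \<longrightarrow> 0 < \<delta> \<longrightarrow> \<delta> \<le> \<delta>0 \<longrightarrow> y \<in> regular \<delta> e"
    by metis
  then obtain D where D: "\<And>x. D x > 0"
    and near: "\<And>x y \<delta>. dist y x < r x \<Longrightarrow> 0 < \<delta> \<Longrightarrow> \<delta> \<le> D x \<Longrightarrow> y \<in> regular \<delta> e"
    by metis
  have "K \<subseteq> (\<Union>x\<in>K. ball x (r x))" using r by auto
  then obtain C where C: "C \<subseteq> K" "finite C" "K \<subseteq> (\<Union>x\<in>C. ball x (r x))"
    using compactE_image[OF assms(1), of K "\<lambda>x. ball x (r x)"] by auto
  define \<delta>0 where "\<delta>0 = Min (insert 1 (D ` C))"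
  show ?thesis
  proof (rule that[of \<delta>0])
    show "\<delta>0 > 0" unfolding \<delta>0_def using C(2) D by (subst Min_gr_iff) auto
    fix \<delta> assume \<delta>: "0 < \<delta>" "\<delta> \<le> \<delta>0"
    show "K \<subseteq> regular \<delta> e"
    proof
      fix y assume "y \<in> K"
      then obtain x where x: "x \<in> C" "dist x y < r x" using C(3) by auto
      have "\<delta>0 \<le> D x" unfolding \<delta>0_def using C(2) x(1) by (intro Min_le) auto
      with x \<delta> show "y \<in> regular \<delta> e" by (intro near[of y x]) (auto simp: dist_commute)
    qed
  qed
qed

lemma sparse_partition_mono:
  assumes "sparse_partition d e f a m t" "d' \<le> d"
  shows "sparse_partition d' e f a m t"
  using assms unfolding sparse_partition_def by (auto intro: order_trans[of "_ + d'" "_ + d"])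

text \<open>
  At scale \<open>k\<close> finitely many values of \<open>\<delta>\<close> serve all the measures, so one gap length, half the least
  of them, serves all the paths in the intersection of the good events.
\<close>

lemma tight_seq_of_regular:
  fixes P :: "nat \<Rightarrow> skorokhod measure"
  assumes prob: "\<And>n. prob_space (P n)" and sets: "\<And>n. sets (P n) = sets borel"
    and norm: "\<And>\<eta>. \<eta> > 0 \<Longrightarrow> \<exists>B. \<forall>n. measure (P n) {x::skorokhod. unif_norm x > B} \<le> \<eta>"
    and reg: "\<And>e \<eta>. e > 0 \<Longrightarrow> \<eta> > 0 \<Longrightarrow>
      \<exists>\<Delta>. finite \<Delta> \<and> \<Delta> \<subseteq> {0<..<1} \<and> (\<forall>n. \<exists>\<delta>\<in>\<Delta>. measure (P n) (- regular \<delta> e) \<le> \<eta>)"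
  shows "tight_seq P"
  unfolding tight_seq_def
proof (intro allI impI)
  fix \<epsilon> :: real assume \<epsilon>: "\<epsilon> > 0"
  have sp: "space (P n) = UNIV" for n using sets_eq_imp_space_eq[OF sets[of n]] by simp
  define e where "e k = inverse (real (Suc k))" for k
  define q where "q k = \<epsilon> / 4 * (1 / 2) ^ k" for k
  have q: "q k > 0" for k using \<epsilon> by (simp add: q_def)
  obtain B where B: "\<And>n. measure (P n) {x::skorokhod. unif_norm x > B} \<le> q 0" using norm[OF q] by blast
  have "\<forall>k. \<exists>\<Delta>. finite \<Delta> \<and> \<Delta> \<subseteq> {0<..<1} \<and> (\<forall>n. \<exists>\<delta>\<in>\<Delta>. measure (P n) (- regular \<delta> (e k)) \<le> q (Suc k))"
    using q by (intro allI reg) (simp_all add: e_def)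
  then obtain \<Delta> where \<Delta>: "\<And>k. finite (\<Delta> k)" "\<And>k. \<Delta> k \<subseteq> {0<..<1}"
    "\<And>k n. \<exists>\<delta>\<in>\<Delta> k. measure (P n) (- regular \<delta> (e k)) \<le> q (Suc k)" by metis
  \<comment> \<open>The bad events, with probabilities at most \<open>q 0, q 1, ...\<close>, a series with sum \<open>\<epsilon> / 2\<close>.\<close>
  define C where "C = case_nat {x::skorokhod. unif_norm x > B} (\<lambda>k. - (\<Union>\<delta>\<in>\<Delta> k. regular \<delta> (e k)))"
  define A where "A = - (\<Union>i. C i)"
  have "{x \<in> space borel. unif_norm (cadlag_fun x) > B} \<in> sets borel"
    using measurable_unif_norm by measurable
  moreover have "(\<Union>\<delta>\<in>\<Delta> k. regular \<delta> (e k)) \<in> sets borel" for k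
    using \<Delta>(1,2)[of k] by (intro sets.finite_UN regular_measurable) auto
  ultimately have C_meas: "C i \<in> sets borel" for i
    by (cases i) (simp_all add: C_def borel_comp del: Compl_UN)
  have C_le: "measure (P n) (C i) \<le> q i" for n i
  proof (cases i)
    case 0
    then show ?thesis using B by (simp add: C_def)
  next
    case (Suc k)
    interpret prob_space "P n" by (rule prob)
    obtain \<delta> where \<delta>: "\<delta> \<in> \<Delta> k" "measure (P n) (- regular \<delta> (e k)) \<le> q (Suc k)" using \<Delta>(3) by blast
    then have "0 < \<delta>" "\<delta> < 1" using \<Delta>(2)[of k] by auto
    then have "- regular \<delta> (e k) \<in> events" using regular_measurable sets by (simp add: borel_comp)
    then have "measure (P n) (C i) \<le> measure (P n) (- regular \<delta> (e k))"
      using \<delta>(1) unfolding Suc C_def by (intro finite_measure_mono) auto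
    with \<delta>(2) show ?thesis by (simp add: Suc)
  qed
  have q_sums: "q sums (\<epsilon> / 2)"
    using sums_mult[OF geometric_sums[of "1 / 2 :: real"], of "\<epsilon> / 4"] unfolding q_def by simp
  have A_large: "measure (P n) (closure A) > 1 - \<epsilon>" for n
  proof -
    interpret prob_space "P n" by (rule prob)
    have summ: "summable (\<lambda>i. measure (P n) (C i))"
      by (rule summable_comparison_test'[OF sums_summable[OF q_sums], of 0]) (use C_le in simp)
    have "measure (P n) (\<Union>i. C i) \<le> (\<Sum>i. measure (P n) (C i))"
      using C_meas sets summ by (intro finite_measure_subadditive_countably) auto
    also have "\<dots> \<le> \<epsilon> / 2"
      using suminf_le[OF C_le summ sums_summable[OF q_sums]] sums_unique[OF q_sums] by simp
    finally have "measure (P n) (\<Union>i. C i) \<le> \<epsilon> / 2" .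
    moreover have "measure (P n) A = 1 - measure (P n) (\<Union>i. C i)"
      using prob_compl[of "\<Union>i. C i"] C_meas sets sp by (auto simp: A_def Compl_eq_Diff_UNIV)
    moreover have "measure (P n) A \<le> measure (P n) (closure A)"
      using sets closure_subset by (intro finite_measure_mono) auto
    ultimately show ?thesis using \<epsilon> by linarith
  qed
  have \<Delta>_ne: "\<Delta> k \<noteq> {}" for k using \<Delta>(3) by blast
  have "compact (closure A)"
  proof (rule compact_closure_sparse_partitions)
    have "0 < Min (\<Delta> k)" for k
      using \<Delta>(1,2)[of k] \<Delta>_ne[of k] by (subst Min_gr_iff) auto
    then show "0 < Min (\<Delta> k) / 2" for k by simp
    show "(\<lambda>k. 6 * e k) \<longlonglongrightarrow> 0"
      using tendsto_mult_right_zero[OF LIMSEQ_inverse_real_of_nat, of 6] unfolding e_def .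
    fix x assume x: "x \<in> A"
    then have "x \<notin> C i" for i by (simp add: A_def)
    from this[of 0] this[of "Suc _"] show "unif_norm x \<le> B"
      and "\<exists>m t. sparse_partition (Min (\<Delta> k) / 2) (6 * e k) x 0 m t" for k
    proof (simp_all add: C_def)
      assume "\<And>k. \<exists>\<delta>\<in>\<Delta> k. x \<in> regular \<delta> (e k)"
      then obtain \<delta> where \<delta>: "\<delta> \<in> \<Delta> k" "x \<in> regular \<delta> (e k)" by blast
      then have "0 < \<delta>" "\<delta> < 1" using \<Delta>(2)[of k] by auto
      then obtain m t where "sparse_partition (\<delta> / 2) (6 * e k) x 0 m t"
        using regular_sparse_partition[OF \<delta>(2)] by blast
      moreover have "Min (\<Delta> k) / 2 \<le> \<delta> / 2" using \<Delta>(1)[of k] \<delta>(1) by simp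
      ultimately show "\<exists>m t. sparse_partition (Min (\<Delta> k) / 2) (6 * e k) x 0 m t"
        using sparse_partition_mono by blast
    qed
  qed
  with A_large show "\<exists>K. compact K \<and> (\<forall>n. measure (P n) K > 1 - \<epsilon>)" by blast
qed

lemma tendsto_0_limsup_ereal_iff:
  fixes q :: "real \<Rightarrow> nat \<Rightarrow> real"
  assumes nonneg: "\<And>a n. q a n \<ge> 0" and anti: "\<And>a b n. a \<le> b \<Longrightarrow> q b n \<le> q a n"
  shows "((\<lambda>a. limsup (\<lambda>n. ereal (q a n))) \<longlongrightarrow> 0) at_top \<longleftrightarrow>
    (\<forall>\<eta>>0. \<exists>a. eventually (\<lambda>n. q a n \<le> \<eta>) sequentially)" (is "?L \<longleftrightarrow> ?R")
proof
  assume L: ?L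
  show ?R
  proof (intro allI impI)
    fix \<eta> :: real assume "\<eta> > 0"
    then have "eventually (\<lambda>a. limsup (\<lambda>n. ereal (q a n)) < ereal \<eta>) at_top"
      using order_tendstoD(2)[OF L, of "ereal \<eta>"] by simp
    then obtain a where "limsup (\<lambda>n. ereal (q a n)) < ereal \<eta>" by (auto simp: eventually_at_top_linorder)
    then have "eventually (\<lambda>n. ereal (q a n) < ereal \<eta>) sequentially" by (rule Limsup_lessD)
    then show "\<exists>a. eventually (\<lambda>n. q a n \<le> \<eta>) sequentially"
      by (intro exI[of _ a]) (auto elim: eventually_mono)
  qed
next
  assume R: ?R
  show ?L
  proof (rule order_tendstoI)
    fix c :: ereal assume "c < 0"
    moreover have "0 \<le> limsup (\<lambda>n. ereal (q a n))" for a
      using nonneg by (intro le_Limsup) auto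
    ultimately show "eventually (\<lambda>a. c < limsup (\<lambda>n. ereal (q a n))) at_top"
      by (intro always_eventually allI) (rule less_le_trans)
  next
    fix c :: ereal assume "0 < c"
    then obtain \<eta> where \<eta>: "0 < ereal \<eta>" "ereal \<eta> < c" using ereal_dense2 by blast
    then obtain a where a: "eventually (\<lambda>n. q a n \<le> \<eta>) sequentially" using R by auto
    have "limsup (\<lambda>n. ereal (q b n)) < c" if "b \<ge> a" for b
    proof -
      have "limsup (\<lambda>n. ereal (q b n)) \<le> ereal \<eta>"
        by (rule Limsup_bounded) (use a in eventually_elim, use anti[OF that] in \<open>auto intro: order_trans\<close>)
      with \<eta> show ?thesis by simp
    qed
    then show "eventually (\<lambda>a. limsup (\<lambda>n. ereal (q a n)) < c) at_top"
      unfolding eventually_at_top_linorder by blast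
  qed
qed

text \<open>
  A condition that holds for all large \<open>n\<close> extends to the finitely many remaining measures because it
  holds for each single one: every path is bounded, and every path is regular for small \<open>\<delta>\<close>.
\<close>

lemma uniform_norm_bound:
  fixes P :: "nat \<Rightarrow> skorokhod measure"
  assumes prob: "\<And>n. prob_space (P n)" and sets: "\<And>n. sets (P n) = sets borel" and \<eta>: "\<eta> > 0"
    and late: "\<And>n. n \<ge> n0 \<Longrightarrow> measure (P n) {x::skorokhod. unif_norm x \<ge> a} \<le> \<eta>"
  shows "\<exists>B. \<forall>n. measure (P n) {x::skorokhod. unif_norm x > B} \<le> \<eta>"
proof -
  have sp: "space (P n) = UNIV" for n using sets_eq_imp_space_eq[OF sets[of n]] by simp
  have "\<exists>j. measure (P n) {x::skorokhod. unif_norm x \<ge> real j} \<le> \<eta>" for n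
  proof -
    interpret prob_space "P n" by (rule prob)
    have "\<exists>j. prob (space (P n) - - {x::skorokhod. unif_norm x \<ge> real j}) < \<eta>"
    proof (rule eventually_in_imp_prob_compl_small[OF _ _ \<eta>])
      show "- {x::skorokhod. unif_norm x \<ge> real j} \<in> events" for j
        using borel_comp[OF unif_norm_ge_measurable] sets by simp
      fix x :: skorokhod
      show "eventually (\<lambda>j. x \<in> - {x. unif_norm (cadlag_fun x) \<ge> real j}) sequentially"
        using eventually_gt_at_top[of "nat \<lceil>unif_norm x\<rceil>"] by eventually_elim (auto, linarith)
    qed
    then show ?thesis using sp by (auto intro: less_imp_le)
  qed
  then obtain b where b: "\<And>n. measure (P n) {x::skorokhod. unif_norm x \<ge> real (b n)} \<le> \<eta>" by metis
  define B where "B = Max (insert a ((\<lambda>n. real (b n)) ` {..<n0}))"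
  have "measure (P n) {x::skorokhod. unif_norm x > B} \<le> \<eta>" for n
  proof -
    interpret prob_space "P n" by (rule prob)
    have "\<exists>c. c \<le> B \<and> measure (P n) {x::skorokhod. unif_norm x \<ge> c} \<le> \<eta>"
    proof (cases "n \<ge> n0")
      case True
      then show ?thesis using late by (intro exI[of _ a]) (auto simp: B_def)
    next
      case False
      then show ?thesis using b by (intro exI[of _ "real (b n)"]) (auto simp: B_def intro!: Max_ge)
    qed
    then obtain c where c: "c \<le> B" "measure (P n) {x::skorokhod. unif_norm x \<ge> c} \<le> \<eta>" by blast
    have "measure (P n) {x::skorokhod. unif_norm x > B} \<le> measure (P n) {x::skorokhod. unif_norm x \<ge> c}"
      using c(1) unif_norm_ge_measurable sets by (intro finite_measure_mono) auto
    with c(2) show ?thesis by simp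
  qed
  then show ?thesis by blast
qed

lemma finitely_many_regular_scales:
  fixes P :: "nat \<Rightarrow> skorokhod measure"
  assumes prob: "\<And>n. prob_space (P n)" and sets: "\<And>n. sets (P n) = sets borel"
    and e: "e > 0" and \<eta>: "\<eta> > 0" and \<delta>: "\<delta> \<in> {0<..<1}"
    and late: "\<And>n. n > n0 \<Longrightarrow> measure (P n) (- regular \<delta> e) \<le> \<eta>"
  shows "\<exists>\<Delta>. finite \<Delta> \<and> \<Delta> \<subseteq> {0<..<1} \<and> (\<forall>n. \<exists>\<delta>\<in>\<Delta>. measure (P n) (- regular \<delta> e) \<le> \<eta>)"
proof -
  have sp: "space (P n) = UNIV" for n using sets_eq_imp_space_eq[OF sets[of n]] by simp
  \<comment> \<open>The shift by \<open>2\<close> keeps the scales in the open unit interval.\<close>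
  have "\<exists>j. measure (P n) (- regular (1 / real (j + 2)) e) \<le> \<eta>" for n
  proof -
    interpret prob_space "P n" by (rule prob)
    have "\<exists>j. prob (space (P n) - regular (1 / real (j + 2)) e) < \<eta>"
    proof (rule eventually_in_imp_prob_compl_small[OF _ _ \<eta>])
      show "regular (1 / real (j + 2)) e \<in> events" for j
        using regular_measurable[of "1 / real (j + 2)" e] sets by simp
      fix x :: skorokhod
      obtain \<delta>0 where \<delta>0: "\<delta>0 > 0" "\<And>\<delta>. 0 < \<delta> \<Longrightarrow> \<delta> \<le> \<delta>0 \<Longrightarrow> {x} \<subseteq> regular \<delta> e"
        using compact_uniformly_regular[of "{x}" e] e by auto
      have "(\<lambda>j. 1 / real (j + 2)) \<longlonglongrightarrow> 0"
        using LIMSEQ_ignore_initial_segment[OF lim_1_over_n, of 2] by simp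
      then have "eventually (\<lambda>j. 1 / real (j + 2) < \<delta>0) sequentially"
        using \<delta>0(1) by (rule order_tendstoD)
      then show "eventually (\<lambda>j. x \<in> regular (1 / real (j + 2)) e) sequentially"
        by eventually_elim (use \<delta>0(2) in auto)
    qed
    then show ?thesis using sp by (auto simp: Compl_eq_Diff_UNIV intro: less_imp_le)
  qed
  then obtain j where j: "\<And>n. measure (P n) (- regular (1 / real (j n + 2)) e) \<le> \<eta>" by metis
  define \<Delta> where "\<Delta> = insert \<delta> ((\<lambda>n. 1 / real (j n + 2)) ` {..n0})"
  have "\<exists>\<delta>'\<in>\<Delta>. measure (P n) (- regular \<delta>' e) \<le> \<eta>" for n
  proof (cases "n > n0")
    case True
    then show ?thesis using late by (auto simp: \<Delta>_def)
  next
    case False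
    then show ?thesis using j[of n] unfolding \<Delta>_def by (intro bexI[of _ "1 / real (j n + 2)"]) auto
  qed
  moreover have "finite \<Delta>" "\<Delta> \<subseteq> {0<..<1}" using \<delta> by (auto simp: \<Delta>_def)
  ultimately show ?thesis by blast
qed

text \<open>
  Every event in (i) and (ii) is controlled by exhibiting it as disjoint from one compact set; the bound is
  the mass outside that set.
\<close>

lemma tight_seq_disjoint_small:
  fixes P :: "nat \<Rightarrow> 'a::t2_space measure"
  assumes prob: "\<And>n. prob_space (P n)" and sets: "\<And>n. sets (P n) = sets borel"
    and tight: "tight_seq P" and \<eta>: "\<eta> > 0"
  obtains K where "compact K" "\<And>n S. S \<inter> K = {} \<Longrightarrow> measure (P n) S \<le> \<eta>"
proof -
  obtain K where K: "compact K" "\<And>n. measure (P n) K > 1 - \<eta>"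
    using tight[unfolded tight_seq_def, rule_format, OF \<eta>] by auto
  have "measure (P n) S \<le> \<eta>" if "S \<inter> K = {}" for n S
  proof -
    interpret prob_space "P n" by (rule prob)
    have Km: "K \<in> events" using K(1) sets by (simp add: borel_compact)
    have "S \<subseteq> space (P n) - K" using that sets_eq_imp_space_eq[OF sets[of n]] by auto
    then have "measure (P n) S \<le> measure (P n) (space (P n) - K)"
      using Km by (intro finite_measure_mono sets.compl_sets)
    also have "\<dots> = 1 - measure (P n) K" by (rule prob_compl[OF Km])
    finally show ?thesis using K(2)[of n] by simp
  qed
  with K(1) show ?thesis by (rule that)
qed

theorem theorem7p12:
  fixes P :: "nat \<Rightarrow> skorokhod measure"
  assumes "\<And>n. prob_space (P n)" and "\<And>n. sets (P n) = sets borel"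
  shows "tight_seq P \<longleftrightarrow>
    ((\<lambda>a::real. limsup (\<lambda>n. ereal (measure (P n) {x::skorokhod. unif_norm x \<ge> a}))) \<longlongrightarrow> 0) at_top \<and>
    (\<forall>\<epsilon>>0::real. \<forall>\<eta>>0::real. \<exists>\<delta>\<in>{0<..<1::real}. \<exists>n\<^sub>0>0. \<forall>n>n\<^sub>0.
       measure (P n) {x::skorokhod. modulus_w'' x \<delta> \<ge> \<epsilon>} \<le> \<eta> \<and>
       measure (P n) {x::skorokhod. \<bar>x \<delta> - x 0\<bar> \<ge> \<epsilon>} \<le> \<eta> \<and>
       measure (P n) {x::skorokhod. \<bar>left_lim x 1 - x (1 - \<delta>)\<bar> \<ge> \<epsilon>} \<le> \<eta>)"
    (is "_ \<longleftrightarrow> ?N \<and> ?R")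
proof -
  have N_iff: "?N \<longleftrightarrow> (\<forall>\<eta>>0. \<exists>a. eventually (\<lambda>n. measure (P n) {x::skorokhod. unif_norm x \<ge> a} \<le> \<eta>) sequentially)"
  proof (rule tendsto_0_limsup_ereal_iff)
    fix a b :: real and n assume "a \<le> b"
    interpret prob_space "P n" by (rule assms(1))
    show "measure (P n) {x::skorokhod. unif_norm x \<ge> b} \<le> measure (P n) {x::skorokhod. unif_norm x \<ge> a}"
      using \<open>a \<le> b\<close> unif_norm_ge_measurable assms(2) by (intro finite_measure_mono) auto
  qed simp
  show ?thesis
  proof
    assume tight: "tight_seq P"
    have ?N
      unfolding N_iff
    proof (intro allI impI)
      fix \<eta> :: real assume "\<eta> > 0"
      then obtain K where K: "compact K" "\<And>n S. S \<inter> K = {} \<Longrightarrow> measure (P n) S \<le> \<eta>"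
        by (rule tight_seq_disjoint_small[OF assms tight]) blast
      obtain B where B: "\<And>x. x \<in> K \<Longrightarrow> unif_norm x \<le> B" using compact_unif_norm_bounded[OF K(1)] by blast
      have "measure (P n) {x::skorokhod. unif_norm x \<ge> B + 1} \<le> \<eta>" for n
        using B by (intro K(2)) force
      then show "\<exists>a. eventually (\<lambda>n. measure (P n) {x::skorokhod. unif_norm x \<ge> a} \<le> \<eta>) sequentially"
        by (intro exI[of _ "B + 1"] always_eventually allI)
    qed
    moreover have ?R
    proof (intro allI impI)
      fix \<epsilon> \<eta> :: real assume "\<epsilon> > 0" "\<eta> > 0"
      obtain K where K: "compact K" "\<And>n S. S \<inter> K = {} \<Longrightarrow> measure (P n) S \<le> \<eta>"
        by (rule tight_seq_disjoint_small[OF assms tight \<open>\<eta> > 0\<close>]) blast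
      obtain \<delta>0 where \<delta>0: "\<delta>0 > 0" "\<And>\<delta>. 0 < \<delta> \<Longrightarrow> \<delta> \<le> \<delta>0 \<Longrightarrow> K \<subseteq> regular \<delta> \<epsilon>"
        using compact_uniformly_regular[OF K(1) \<open>\<epsilon> > 0\<close>] by blast
      define \<delta> where "\<delta> = min \<delta>0 (1 / 2)"
      have "\<delta> \<in> {0<..<1}" "K \<subseteq> regular \<delta> \<epsilon>" using \<delta>0 by (auto simp: \<delta>_def)
      then have "measure (P n) {x::skorokhod. modulus_w'' x \<delta> \<ge> \<epsilon>} \<le> \<eta> \<and>
         measure (P n) {x::skorokhod. \<bar>x \<delta> - x 0\<bar> \<ge> \<epsilon>} \<le> \<eta> \<and>
         measure (P n) {x::skorokhod. \<bar>left_lim x 1 - x (1 - \<delta>)\<bar> \<ge> \<epsilon>} \<le> \<eta>" for n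
        by (intro conjI K(2)) (auto simp: regular_def)
      then show "\<exists>\<delta>\<in>{0<..<1::real}. \<exists>n\<^sub>0>0. \<forall>n>n\<^sub>0.
         measure (P n) {x::skorokhod. modulus_w'' x \<delta> \<ge> \<epsilon>} \<le> \<eta> \<and>
         measure (P n) {x::skorokhod. \<bar>x \<delta> - x 0\<bar> \<ge> \<epsilon>} \<le> \<eta> \<and>
         measure (P n) {x::skorokhod. \<bar>left_lim x 1 - x (1 - \<delta>)\<bar> \<ge> \<epsilon>} \<le> \<eta>"
        using \<open>\<delta> \<in> {0<..<1}\<close> by (intro bexI[of _ \<delta>] exI[of _ 1]) auto
    qed
    ultimately show "?N \<and> ?R" ..
  next
    assume "?N \<and> ?R"
    then have N: "\<And>\<eta>. \<eta> > 0 \<Longrightarrow> \<exists>a. eventually (\<lambda>n. measure (P n) {x::skorokhod. unif_norm x \<ge> a} \<le> \<eta>) sequentially"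
      and R: ?R unfolding N_iff by auto
    show "tight_seq P"
    proof (rule tight_seq_of_regular[OF assms])
      fix \<eta> :: real assume \<eta>: "\<eta> > 0"
      obtain a n0 where "\<And>n. n \<ge> n0 \<Longrightarrow> measure (P n) {x::skorokhod. unif_norm x \<ge> a} \<le> \<eta>"
        using N[OF \<eta>] unfolding eventually_sequentially by blast
      then show "\<exists>B. \<forall>n. measure (P n) {x::skorokhod. unif_norm x > B} \<le> \<eta>"
        by (rule uniform_norm_bound[OF assms \<eta>])
    next
      fix e \<eta> :: real assume e: "e > 0" and \<eta>: "\<eta> > 0"
      then have "\<eta> / 3 > 0" by simp
      with R e obtain \<delta> n0 where \<delta>: "\<delta> \<in> {0<..<1}" and n0: "\<And>n. n > n0 \<Longrightarrow>
         measure (P n) {x::skorokhod. modulus_w'' x \<delta> \<ge> e} \<le> \<eta> / 3 \<and>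
         measure (P n) {x::skorokhod. \<bar>x \<delta> - x 0\<bar> \<ge> e} \<le> \<eta> / 3 \<and>
         measure (P n) {x::skorokhod. \<bar>left_lim x 1 - x (1 - \<delta>)\<bar> \<ge> e} \<le> \<eta> / 3"
        by blast
      have "measure (P n) (- regular \<delta> e) \<le> \<eta>" if n: "n > n0" for n
      proof -
        interpret prob_space "P n" by (rule assms(1))
        let ?A = "{x::skorokhod. modulus_w'' x \<delta> \<ge> e}" and ?B = "{x::skorokhod. \<bar>x \<delta> - x 0\<bar> \<ge> e}"
          and ?C = "{x::skorokhod. \<bar>left_lim x 1 - x (1 - \<delta>)\<bar> \<ge> e}"
        have m: "?A \<in> events" "?B \<in> events" "?C \<in> events"
          using irregular_measurable[of \<delta> e] \<delta> assms(2) by simp_all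
        have eq: "- regular \<delta> e = ?A \<union> (?B \<union> ?C)" by (simp add: regular_eq_Compl Un_assoc)
        have "measure (P n) (?A \<union> (?B \<union> ?C)) \<le> measure (P n) ?A + measure (P n) (?B \<union> ?C)"
          using m by (intro measure_Un_le sets.Un)
        also have "measure (P n) (?B \<union> ?C) \<le> measure (P n) ?B + measure (P n) ?C"
          using m by (intro measure_Un_le sets.Un)
        finally show ?thesis using n0[OF n] unfolding eq by linarith
      qed
      then show "\<exists>\<Delta>. finite \<Delta> \<and> \<Delta> \<subseteq> {0<..<1} \<and> (\<forall>n. \<exists>\<delta>\<in>\<Delta>. measure (P n) (- regular \<delta> e) \<le> \<eta>)"
        by (rule finitely_many_regular_scales[OF assms e \<eta> \<delta>])
    qed
  qed
qed

end
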